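(* Let $e\ge 1$, let $\mathbf m=(m_0,\dots,m_{e-1})$ be positive integers, let $r\ge s\ge 0$ be integers, let $n\ge 0$, and let $\prec$ be a fixed total order on $Z_n^{0,0}=Z_n^{0,0}(\mathbf m)$ such that $a(\alpha)\ge a(\beta)$ whenever $\alpha\prec\beta$ and such that each family in $Z_n^{0,0}$ forms an interval. Then there exist unique functions $P^{+}_{\Lambda}(x;q,t),\,P^{-}_{\Lambda}(x;q,t)\in\Xi_F$, for $\Lambda\in Z_n^{r,s}$, satisfying the following two properties. (i) For $\Lambda=\Lambda(\alpha)$ with $\alpha\in Z_n^{0,0}$, and for each sign $\pm$, one has $$P^{\pm}_{\Lambda}=s_{\alpha}+\sum_{\beta}u^{\pm}_{\alpha,\beta}\,s_{\beta}$$ with $u^{\pm}_{\alpha,\beta}\in F$, where $u^{\pm}_{\alpha,\beta}=0$ unless $\beta\prec\alpha$ and $\beta\not\sim\alpha$ (the sum being over $\beta\in Z_n^{0,0}$). (ii) $\langle P^{+}_{\Lambda},P^{-}_{\Lambda'}\rangle=0$ unless $\Lambda\sim\Lambda'$.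
   Context: **Symmetric functions.** $\zeta$ is a primitive $e$-th root of unity in $\mathbb C$, and $F=\mathbb C(q,t)$ with $q,t$ independent indeterminates. For each $k\in\{0,\dots,e-1\}$ let $x^{(k)}=(x^{(k)}_1,x^{(k)}_2,\dots)$ be an infinite set of variables. $\Xi_F$ is the $F$-algebra $\bigotimes_{k}\Lambda_F(x^{(k)})$, where $\Lambda_F(x^{(k)})$ is the usual ring of symmetric functions in $x^{(k)}$ with coefficients in $F$. An $e$-partition of $n$ is $\alpha=(\alpha^{(0)},\dots,\alpha^{(e-1)})$, a tuple of partitions with $\sum_k|\alpha^{(k)}|=n$; put $s_\alpha(x)=\prod_k s_{\alpha^{(k)}}(x^{(k)})$ (usual Schur functions). For $r\ge1$ and $0\le i\le e-1$ put $p^{(i)}_r(x)=\sum_{j=0}^{e-1}\zeta^{ij}p_r(x^{(j)})$ with $p_r$ the usual power sum, and $p_0^{(i)}=1$; put $p_\alpha(x)=\prod_{k}\prod_{j}p^{(k)}_{\alpha^{(k)}_j}(x)$. The $p_\alpha$ form an $F$-basis of $\Xi_F$. **Sesquilinear form.** For a partition $\alpha=(1^{n_1},2^{n_2},\dots)$ let $z_\alpha=\prod_{i\ge1} i^{n_i}n_i!$ and let $l(\alpha)$ be its number of nonzero parts. For an $e$-partition $\alpha$ put $$z_{\alpha}=e^{\sum_k l(\alpha^{(k)})}\prod_{k}z_{\alpha^{(k)}},\qquad z_{\alpha}(q,t)=z_\alpha\prod_{k=0}^{e-1}\prod_{j=1}^{l(\alpha^{(k)})}\frac{1-\zeta^kq^{\alpha^{(k)}_j}}{1-\zeta^kt^{\alpha^{(k)}_j}}.$$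 $\langle\ ,\ \rangle$ is the sesquilinear form on $\Xi_F$ (linear in the first variable, conjugate-linear in the second with respect to complex conjugation of coefficients fixing $q$ and $t$) with $\langle p_\alpha,p_\beta\rangle=\delta_{\alpha,\beta}z_\alpha(q,t)$ for all $e$-partitions $\alpha,\beta$. **Symbols.** $Z_n^{0,0}=Z_n^{0,0}(\mathbf m)$ is the set of $e$-partitions $\alpha$ of $n$ with each $\alpha^{(k)}$ written as $\alpha^{(k)}_1\ge\dots\ge\alpha^{(k)}_{m_k}\ge0$ (so with at most $m_k$ nonzero parts). Let $\Lambda^0=(\Lambda^{0,(0)},\dots,\Lambda^{0,(e-1)})$ with $\Lambda^{0,(0)}=((m_0-1)r,\dots,2r,r,0)$ and $\Lambda^{0,(i)}=(s+(m_i-1)r,\dots,s+r,s)$ for $1\le i\le e-1$. $Z_n^{r,s}=Z_n^{r,s}(\mathbf m)$ is the set of $\Lambda(\alpha)=\alpha+\Lambda^0$ (entrywise sum), $\alpha\in Z_n^{0,0}$. Two symbols $\Lambda,\Lambda'\in Z_n^{r,s}$ are similar, $\Lambda\sim\Lambda'$, if the multisets of all their entries coincide; similarity classes are called families. The function $a$ on $Z_n^{r,s}$ is $$a(\Lambda)=\sum_{\{\lambda,\lambda'\}\subset\Lambda}\min\{\lambda,\lambda'\}-\sum_{\{\mu,\mu'\}\subset\Lambda^0}\min\{\mu,\mu'\},$$ the sums being over unordered pairs of entries in different positions. Via the bijection $\alpha\mapsto\Lambda(\alpha)$, the notions $\sim$, family, and $a$ are transported to $Z_n^{0,0}$ (so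 they depend on $r,s,\mathbf m$). *)

theory Defs
  imports
    Complex_Main
    "HOL-Library.Multiset"
    "HOL-Library.FuncSet"
    "HOL-Computational_Algebra.Polynomial"
    "HOL-Computational_Algebra.Fraction_Field"
begin

section \<open>The coefficient field \<open>F = \<complex>(q,t)\<close>\<close>

text \<open>\<open>F\<close> is the fraction field of \<open>\<complex>[q][t]\<close>: the inner polynomial variable is \<open>q\<close>,
  the outer one is \<open>t\<close>.\<close>

type_synonym F = "complex poly poly fract"

definition F_const :: "complex \<Rightarrow> F" where
  "F_const c = Fract [:[:c:]:] 1"

definition F_q :: F where
  "F_q = Fract [:[:0, 1:]:] 1"

definition F_t :: F where
  "F_t = Fract [:0, 1:] 1"

definition cnj_poly2 :: "complex poly poly \<Rightarrow> complex poly poly" where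
  "cnj_poly2 = map_poly (map_poly cnj)"

lemma map_poly_mult_hom:
  fixes h :: "'a::comm_semiring_0 \<Rightarrow> 'b::comm_semiring_0"
  assumes h0: "h 0 = 0" and ha: "\<And>x y. h (x + y) = h x + h y"
    and hm: "\<And>x y. h (x * y) = h x * h y"
  shows "map_poly h (p * r) = map_poly h p * map_poly h r"
proof -
  have hs: "h (sum g A) = (\<Sum>a\<in>A. h (g a))" for g and A :: "nat set"
    by (induction A rule: infinite_finite_induct) (auto simp: h0 ha)
  show ?thesis
    by (rule poly_eqI) (simp add: coeff_map_poly h0 coeff_mult hs hm)
qed

lemma map_poly_add_hom:
  assumes "h 0 = 0" "\<And>x y. h (x + y) = h x + h y"
  shows "map_poly h (p + r) = map_poly h p + map_poly h r"
  by (rule poly_eqI) (simp add: coeff_map_poly assms)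

lemma cnj_poly2_mult: "cnj_poly2 (p * r) = cnj_poly2 p * cnj_poly2 r"
  unfolding cnj_poly2_def
  by (intro map_poly_mult_hom map_poly_add_hom) simp_all

lemma map_poly_cnj_eq_0_iff: "map_poly cnj p = 0 \<longleftrightarrow> p = 0"
  by (auto simp: poly_eq_iff coeff_map_poly)

lemma cnj_poly2_eq_0_iff [simp]: "cnj_poly2 p = 0 \<longleftrightarrow> p = 0"
  by (auto simp: cnj_poly2_def poly_eq_iff[of _ "0 :: complex poly poly"] coeff_map_poly
      map_poly_cnj_eq_0_iff)

text \<open>Complex conjugation of the coefficients of a rational function, fixing \<open>q\<close> and \<open>t\<close>.\<close>

lift_definition F_cnj :: "F \<Rightarrow> F" is "\<lambda>(a, b). (cnj_poly2 a, cnj_poly2 b)"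
  by (auto simp: cnj_poly2_mult[symmetric])

definition primitive_root_of_unity :: "nat \<Rightarrow> complex \<Rightarrow> bool" where
  "primitive_root_of_unity e \<zeta> \<longleftrightarrow>
     e > 0 \<and> \<zeta> ^ e = 1 \<and> (\<forall>k. 0 < k \<and> k < e \<longrightarrow> \<zeta> ^ k \<noteq> 1)"


section \<open>Formal power series in arbitrarily many variables\<close>

text \<open>A monomial in variables from \<open>'v\<close> is a finite multiset of variables; its degree is the
  size of the multiset, and the product of two monomials is their multiset sum.\<close>

typedef ('v, 'a) mseries = "UNIV :: ('v multiset \<Rightarrow> 'a) set"
  morphisms mcoeff MSeries by simp

setup_lifting type_definition_mseries

lemma mseries_eqI: "(\<And>M. mcoeff f M = mcoeff g M) \<Longrightarrow> f = g"
  by transfer auto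

lemma finite_splits: "finite {(A, B). A + B = (M :: 'v multiset)}"
proof -
  have fin: "finite {A. A \<subseteq># M}"
  proof (induction M)
    case (add x M)
    have "{A. A \<subseteq># add_mset x M} \<subseteq> {A. A \<subseteq># M} \<union> add_mset x ` {A. A \<subseteq># M}"
    proof
      fix A assume A: "A \<in> {A. A \<subseteq># add_mset x M}"
      show "A \<in> {A. A \<subseteq># M} \<union> add_mset x ` {A. A \<subseteq># M}"
      proof (cases "x \<in># A")
        case True
        then obtain A' where "A = add_mset x A'" by (metis insert_DiffM)
        then show ?thesis using A by auto
      next
        case False
        then have "A \<subseteq># M" using A
          by (metis diff_single_trivial mem_Collect_eq subset_eq_diff_conv add_mset_add_single)
        then show ?thesis by auto
      qed
    qed
    then show ?case using add by (meson finite_UnI finite_imageI finite_subset)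
  qed simp
  have "{(A, B). A + B = M} \<subseteq> {A. A \<subseteq># M} \<times> {A. A \<subseteq># M}" by auto
  then show ?thesis using fin by (meson finite_SigmaI finite_subset)
qed

instantiation mseries :: (type, comm_ring_1) comm_ring_1
begin

lift_definition zero_mseries :: "('a, 'b) mseries" is "\<lambda>_. 0" .
lift_definition one_mseries :: "('a, 'b) mseries" is "\<lambda>M. if M = {#} then 1 else 0" .
lift_definition plus_mseries :: "('a, 'b) mseries \<Rightarrow> ('a, 'b) mseries \<Rightarrow> ('a, 'b) mseries"
  is "\<lambda>f g M. f M + g M" .
lift_definition minus_mseries :: "('a, 'b) mseries \<Rightarrow> ('a, 'b) mseries \<Rightarrow> ('a, 'b) mseries"
  is "\<lambda>f g M. f M - g M" .
lift_definition uminus_mseries :: "('a, 'b) mseries \<Rightarrow> ('a, 'b) mseries"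
  is "\<lambda>f M. - f M" .
lift_definition times_mseries :: "('a, 'b) mseries \<Rightarrow> ('a, 'b) mseries \<Rightarrow> ('a, 'b) mseries"
  is "\<lambda>f g M. \<Sum>(A, B)\<in>{(A, B). A + B = M}. f A * g B" .

instance
proof
  fix f g h :: "('a, 'b) mseries"
  show "f * g * h = f * (g * h)"
  proof (transfer, rule ext)
    fix f g h :: "'a multiset \<Rightarrow> 'b" and M :: "'a multiset"
    let ?S = "\<lambda>M :: 'a multiset. {(A, B). A + B = M}"
    have "(\<Sum>(A, B)\<in>?S M. (\<Sum>(A, B)\<in>?S A. f A * g B) * h B)
        = (\<Sum>x\<in>?S M. \<Sum>y\<in>?S (fst x). f (fst y) * g (snd y) * h (snd x))"
      by (simp add: case_prod_beta sum_distrib_right)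
    also have "\<dots> = (\<Sum>(x, y)\<in>(SIGMA x:?S M. ?S (fst x)). f (fst y) * g (snd y) * h (snd x))"
      by (rule sum.Sigma) (auto simp: finite_splits)
    also have "\<dots> = (\<Sum>(x, y)\<in>(SIGMA x:?S M. ?S (snd x)). f (fst x) * (g (fst y) * h (snd y)))"
      by (rule sum.reindex_bij_witness
          [where i = "\<lambda>((a, b), (c, d)). ((a + c, d), (a, c))"
             and j = "\<lambda>((a, b), (c, d)). ((c, d + b), (d, b))"])
         (auto simp: ac_simps)
    also have "\<dots> = (\<Sum>x\<in>?S M. \<Sum>y\<in>?S (snd x). f (fst x) * (g (fst y) * h (snd y)))"
      by (rule sum.Sigma[symmetric]) (auto simp: finite_splits)
    also have "\<dots> = (\<Sum>(A, B)\<in>?S M. f A * (\<Sum>(A, B)\<in>?S B. g A * h B))"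
      by (simp add: case_prod_beta sum_distrib_left)
    finally show "(\<Sum>(A, B)\<in>?S M. (\<Sum>(A, B)\<in>?S A. f A * g B) * h B)
        = (\<Sum>(A, B)\<in>?S M. f A * (\<Sum>(A, B)\<in>?S B. g A * h B))" .
  qed
  show "f * g = g * f"
  proof (transfer, rule ext)
    fix f g :: "'a multiset \<Rightarrow> 'b" and M
    show "(\<Sum>(A, B)\<in>{(A, B). A + B = M}. f A * g B) = (\<Sum>(A, B)\<in>{(A, B). A + B = M}. g A * f B)"
      by (rule sum.reindex_bij_witness[where i = prod.swap and j = prod.swap])
         (auto simp: ac_simps)
  qed
  show "1 * f = f"
  proof (transfer, rule ext)
    fix f :: "'a multiset \<Rightarrow> 'b" and M
    have "(\<Sum>(A, B)\<in>{(A, B). A + B = M}. (if A = {#} then 1 else 0) * f B)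
        = (\<Sum>(A, B)\<in>{({#} :: 'a multiset, M)}. (if A = {#} then 1 else 0) * f B)"
      by (rule sum.mono_neutral_right) (auto simp: finite_splits split: if_splits)
    then show "(\<Sum>(A, B)\<in>{(A, B). A + B = M}. (if A = {#} then 1 else 0) * f B) = f M"
      by simp
  qed
  show "(f + g) * h = f * h + g * h"
    by transfer (simp add: case_prod_beta distrib_right sum.distrib)
  show "(0 :: ('a, 'b) mseries) \<noteq> 1"
    by transfer (auto simp: fun_eq_iff)
qed (transfer; simp add: fun_eq_iff algebra_simps)+

end

lift_definition mscale :: "'a::comm_ring_1 \<Rightarrow> ('v, 'a) mseries \<Rightarrow> ('v, 'a) mseries"
  is "\<lambda>c f M. c * f M" .

interpretation mseries: vector_space "mscale :: 'a::field \<Rightarrow> ('v, 'a) mseries \<Rightarrow> ('v, 'a) mseries"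
  by unfold_locales (transfer; simp add: fun_eq_iff algebra_simps)+


section \<open>Symmetric functions\<close>

text \<open>The pair \<open>(k, i)\<close> stands for the variable \<open>x\<^sup>(\<^sup>k\<^sup>)\<close> with (0-based) index \<open>i\<close>.\<close>

type_synonym series = "(nat \<times> nat, F) mseries"

text \<open>The ring of symmetric functions in the \<open>k\<close>-th alphabet: series of bounded degree in the
  variables of that alphabet only, invariant under permuting these variables.\<close>

definition Sym :: "nat \<Rightarrow> series set" where
  "Sym k = {f.
     (\<forall>M. mcoeff f M \<noteq> 0 \<longrightarrow> (\<forall>v\<in>#M. fst v = k)) \<and>
     (\<exists>d. \<forall>M. mcoeff f M \<noteq> 0 \<longrightarrow> size M \<le> d) \<and>
     (\<forall>\<pi> M. bij \<pi> \<longrightarrow> mcoeff f (image_mset (map_prod id \<pi>) M) = mcoeff f M)}"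

text \<open>The tensor product of the rings \<open>Sym k\<close> (\<open>k < e\<close>) over \<open>F\<close>. As the alphabets are disjoint,
  it is the linear span of the products inside the ring of all power series.\<close>

definition Xi :: "nat \<Rightarrow> series set" where
  "Xi e = mseries.span {\<Prod>k<e. f k | f. \<forall>k<e. f k \<in> Sym k}"


subsection \<open>Partitions\<close>

text \<open>Partitions are weakly decreasing sequences of natural numbers with finitely many nonzero
  entries. Indices start at 0, so the part \<open>\<lambda>\<^sub>j\<close> of the usual notation is \<open>l (j - 1)\<close>.\<close>

definition partition :: "(nat \<Rightarrow> nat) \<Rightarrow> bool" where
  "partition l \<longleftrightarrow> antimono l \<and> finite {j. l j \<noteq> 0}"

definition psize :: "(nat \<Rightarrow> nat) \<Rightarrow> nat" where
  "psize l = (\<Sum>j | l j \<noteq> 0. l j)"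

definition plen :: "(nat \<Rightarrow> nat) \<Rightarrow> nat" where
  "plen l = card {j. l j \<noteq> 0}"

type_synonym epart = "nat \<Rightarrow> nat \<Rightarrow> nat"

text \<open>Components with index \<open>k \<ge> e\<close> are fixed to be the empty partition, so that
  every \<open>e\<close>-partition is represented exactly once.\<close>

definition epartitions :: "nat \<Rightarrow> epart set" where
  "epartitions e = {\<alpha>. (\<forall>k<e. partition (\<alpha> k)) \<and> (\<forall>k\<ge>e. \<alpha> k = (\<lambda>_. 0))}"


subsection \<open>Schur functions\<close>

definition cells :: "(nat \<Rightarrow> nat) \<Rightarrow> (nat \<times> nat) set" where
  "cells l = {(i, j). j < l i}"

text \<open>Semistandard tableaux: entries weakly increase along rows, strictly down columns.\<close>

definition ssyt :: "(nat \<Rightarrow> nat) \<Rightarrow> (nat \<times> nat \<Rightarrow> nat) set" where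
  "ssyt l = {T \<in> extensional (cells l).
     (\<forall>i j. (i, Suc j) \<in> cells l \<longrightarrow> T (i, j) \<le> T (i, Suc j)) \<and>
     (\<forall>i j. (Suc i, j) \<in> cells l \<longrightarrow> T (i, j) < T (Suc i, j))}"

definition schur :: "nat \<Rightarrow> (nat \<Rightarrow> nat) \<Rightarrow> series" where
  "schur k l = MSeries (\<lambda>M.
     of_nat (card {T \<in> ssyt l. image_mset (\<lambda>c. (k, T c)) (mset_set (cells l)) = M}))"

definition schur_ep :: "nat \<Rightarrow> epart \<Rightarrow> series" where
  "schur_ep e \<alpha> = (\<Prod>k<e. schur k (\<alpha> k))"


subsection \<open>Power sums\<close>

text \<open>Only meant for \<open>r > 0\<close>.\<close>

definition psum :: "nat \<Rightarrow> nat \<Rightarrow> series" where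
  "psum k r = MSeries (\<lambda>M. if \<exists>i. M = replicate_mset r (k, i) then 1 else 0)"

definition psum_tw :: "nat \<Rightarrow> complex \<Rightarrow> nat \<Rightarrow> nat \<Rightarrow> series" where
  "psum_tw e \<zeta> i r =
     (if r = 0 then 1 else \<Sum>j<e. mscale (F_const (\<zeta> ^ (i * j))) (psum j r))"

definition psum_ep :: "nat \<Rightarrow> complex \<Rightarrow> epart \<Rightarrow> series" where
  "psum_ep e \<zeta> \<alpha> = (\<Prod>k<e. \<Prod>j | \<alpha> k j \<noteq> 0. psum_tw e \<zeta> k (\<alpha> k j))"


section \<open>The sesquilinear form\<close>

definition z_part :: "(nat \<Rightarrow> nat) \<Rightarrow> nat" where
  "z_part l = (\<Prod>i \<in> range l - {0}. i ^ card {j. l j = i} * fact (card {j. l j = i}))"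

definition z_ep :: "nat \<Rightarrow> epart \<Rightarrow> nat" where
  "z_ep e \<alpha> = e ^ (\<Sum>k<e. plen (\<alpha> k)) * (\<Prod>k<e. z_part (\<alpha> k))"

definition z_qt :: "nat \<Rightarrow> complex \<Rightarrow> epart \<Rightarrow> F" where
  "z_qt e \<zeta> \<alpha> = of_nat (z_ep e \<alpha>) *
     (\<Prod>k<e. \<Prod>j | \<alpha> k j \<noteq> 0.
        (1 - F_const (\<zeta> ^ k) * F_q ^ \<alpha> k j) / (1 - F_const (\<zeta> ^ k) * F_t ^ \<alpha> k j))"

text \<open>The coordinates of an element of \<open>Xi e\<close> with respect to the basis of the power sum products
  \<open>psum_ep e \<zeta> \<alpha>\<close>, where \<open>\<alpha>\<close> runs over all \<open>e\<close>-partitions.\<close>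

definition psum_coords :: "nat \<Rightarrow> complex \<Rightarrow> series \<Rightarrow> epart \<Rightarrow> F" where
  "psum_coords e \<zeta> f = (THE c. finite {\<alpha>. c \<alpha> \<noteq> 0} \<and> {\<alpha>. c \<alpha> \<noteq> 0} \<subseteq> epartitions e \<and>
     f = (\<Sum>\<alpha> | c \<alpha> \<noteq> 0. mscale (c \<alpha>) (psum_ep e \<zeta> \<alpha>)))"

text \<open>The form that is linear in the first and conjugate-linear in the second variable, and takes
  the value \<open>z_qt e \<zeta> \<alpha>\<close> or 0 on a pair of basis elements \<open>\<alpha>\<close>, \<open>\<beta>\<close>
  according to whether \<open>\<alpha> = \<beta>\<close> or not.\<close>

definition Xi_form :: "nat \<Rightarrow> complex \<Rightarrow> series \<Rightarrow> series \<Rightarrow> F" where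
  "Xi_form e \<zeta> f g =
     (\<Sum>\<alpha> | psum_coords e \<zeta> f \<alpha> \<noteq> 0.
        psum_coords e \<zeta> f \<alpha> * F_cnj (psum_coords e \<zeta> g \<alpha>) * z_qt e \<zeta> \<alpha>)"


section \<open>Symbols\<close>

definition Z0 :: "nat \<Rightarrow> (nat \<Rightarrow> nat) \<Rightarrow> nat \<Rightarrow> epart set" where
  "Z0 e m n = {\<alpha> \<in> epartitions e. (\<Sum>k<e. psize (\<alpha> k)) = n \<and> (\<forall>k<e. \<forall>j\<ge>m k. \<alpha> k j = 0)}"

text \<open>A symbol has the entries \<open>\<Lambda> k j\<close> for the positions \<open>(k, j)\<close> below; the values at all other
  arguments are irrelevant and set to 0.\<close>

type_synonym symb = "nat \<Rightarrow> nat \<Rightarrow> nat"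

definition positions :: "nat \<Rightarrow> (nat \<Rightarrow> nat) \<Rightarrow> (nat \<times> nat) set" where
  "positions e m = (SIGMA k:{..<e}. {..<m k})"

definition symbol0 :: "nat \<Rightarrow> (nat \<Rightarrow> nat) \<Rightarrow> nat \<Rightarrow> nat \<Rightarrow> symb" where
  "symbol0 e m r s k j =
     (if (k, j) \<in> positions e m then (if k = 0 then 0 else s) + (m k - 1 - j) * r else 0)"

definition symbol :: "nat \<Rightarrow> (nat \<Rightarrow> nat) \<Rightarrow> nat \<Rightarrow> nat \<Rightarrow> epart \<Rightarrow> symb" where
  "symbol e m r s \<alpha> k j = \<alpha> k j + symbol0 e m r s k j"

definition symbols :: "nat \<Rightarrow> (nat \<Rightarrow> nat) \<Rightarrow> nat \<Rightarrow> nat \<Rightarrow> nat \<Rightarrow> symb set" where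
  "symbols e m r s n = symbol e m r s ` Z0 e m n"

definition similar :: "nat \<Rightarrow> (nat \<Rightarrow> nat) \<Rightarrow> symb \<Rightarrow> symb \<Rightarrow> bool" where
  "similar e m L L' \<longleftrightarrow>
     image_mset (case_prod L) (mset_set (positions e m)) =
     image_mset (case_prod L') (mset_set (positions e m))"

definition min_sum :: "nat \<Rightarrow> (nat \<Rightarrow> nat) \<Rightarrow> symb \<Rightarrow> nat" where
  "min_sum e m L = (\<Sum>X | X \<subseteq> positions e m \<and> card X = 2. Min (case_prod L ` X))"

definition a_fun :: "nat \<Rightarrow> (nat \<Rightarrow> nat) \<Rightarrow> nat \<Rightarrow> nat \<Rightarrow> symb \<Rightarrow> int" where
  "a_fun e m r s L = int (min_sum e m L) - int (min_sum e m (symbol0 e m r s))"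

definition similar_ep :: "nat \<Rightarrow> (nat \<Rightarrow> nat) \<Rightarrow> nat \<Rightarrow> nat \<Rightarrow> epart \<Rightarrow> epart \<Rightarrow> bool" where
  "similar_ep e m r s \<alpha> \<beta> \<longleftrightarrow> similar e m (symbol e m r s \<alpha>) (symbol e m r s \<beta>)"

text \<open>\<open>prec\<close> is the strict relation; the last conjunct says that families are intervals.\<close>

definition admissible_order ::
  "nat \<Rightarrow> (nat \<Rightarrow> nat) \<Rightarrow> nat \<Rightarrow> nat \<Rightarrow> nat \<Rightarrow> (epart \<times> epart) set \<Rightarrow> bool" where
  "admissible_order e m r s n prec \<longleftrightarrow>
     prec \<subseteq> Z0 e m n \<times> Z0 e m n \<and>
     strict_linear_order_on (Z0 e m n) prec \<and>
     (\<forall>(\<alpha>, \<beta>)\<in>prec.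
        a_fun e m r s (symbol e m r s \<alpha>) \<ge> a_fun e m r s (symbol e m r s \<beta>)) \<and>
     (\<forall>\<alpha> \<beta> \<gamma>. (\<alpha>, \<beta>) \<in> prec \<and> (\<beta>, \<gamma>) \<in> prec \<and> similar_ep e m r s \<alpha> \<gamma> \<longrightarrow>
        similar_ep e m r s \<alpha> \<beta>)"

text \<open>\<open>P\<close> has the form \<open>s\<^sub>\<alpha> + \<Sum>\<^sub>\<beta> u\<^sub>\<beta> s\<^sub>\<beta>\<close>, where \<open>u\<^sub>\<beta>\<close> vanishes unless \<open>\<beta> \<prec> \<alpha>\<close> and \<open>\<beta>\<close>
  is not similar to \<open>\<alpha>\<close>.\<close>

definition unitriangular_at ::
  "nat \<Rightarrow> (nat \<Rightarrow> nat) \<Rightarrow> nat \<Rightarrow> nat \<Rightarrow> nat \<Rightarrow> (epart \<times> epart) set \<Rightarrow> epart \<Rightarrow> series \<Rightarrow> bool" where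
  "unitriangular_at e m r s n prec \<alpha> P \<longleftrightarrow>
     (\<exists>u :: epart \<Rightarrow> F.
        (\<forall>\<beta>. u \<beta> \<noteq> 0 \<longrightarrow> (\<beta>, \<alpha>) \<in> prec \<and> \<not> similar_ep e m r s \<beta> \<alpha>) \<and>
        P = schur_ep e \<alpha> + (\<Sum>\<beta>\<in>Z0 e m n. mscale (u \<beta>) (schur_ep e \<beta>)))"

end

theory Submission
  imports Defs "HOL-Combinatorics.Transposition"
begin

text \<open>
  Condition (ii) is a Gram--Schmidt condition for a form that is sesquilinear but not Hermitian.
  Let \<open>V\<^sub>\<alpha>\<close> be the span of the \<open>s\<^sub>\<beta>\<close> with \<open>\<beta> \<prec> \<alpha>\<close> and \<open>\<beta> \<not>\<sim> \<alpha>\<close>. Because families are intervals,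
  \<open>V\<^sub>\<alpha>\<close> is also the span of the \<open>P\<^sup>-\<^sub>\<beta>\<close> for the same \<open>\<beta>\<close>, as soon as these have the triangular
  shape (i), and the same holds for \<open>P\<^sup>+\<close>. Thus (ii) says exactly that \<open>P\<^sup>+\<^sub>\<alpha>\<close> is left orthogonal
  and \<open>P\<^sup>-\<^sub>\<alpha>\<close> right orthogonal to \<open>V\<^sub>\<alpha>\<close>, and (i) says that both lie in \<open>s\<^sub>\<alpha> + V\<^sub>\<alpha>\<close>. Such vectors exist
  and are unique if the form is anisotropic, that is, if \<open>\<langle>f, f\<rangle> = 0\<close> only for \<open>f = 0\<close>: then it is
  nondegenerate on every finite-dimensional subspace. This argument is carried out in the locales
  \<open>anisotropic_form\<close> and \<open>block_triangular\<close>.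

  For anisotropy, expand \<open>f\<close> in the power sum products: \<open>\<langle>f, f\<rangle>\<close> is the sum of the
  \<open>c\<^sub>\<alpha> \<cdot> cnj c\<^sub>\<alpha> \<cdot> z\<^sub>\<alpha>(q,t)\<close>. Order the monomials in \<open>q, t\<close> lexicographically and call a rational
  function positive if the quotient of the leading coefficients of its numerator and denominator
  is a positive real. Sums and products of positive elements are positive, \<open>c \<cdot> cnj c\<close> is positive
  for \<open>c \<noteq> 0\<close>, and the factors of \<open>z\<^sub>\<alpha>(q,t)\<close> are positive because the leading coefficients of
  \<open>1 - \<zeta>\<^sup>k q\<^sup>r\<close> and \<open>1 - \<zeta>\<^sup>k t\<^sup>r\<close> are equal. A sum with at least one positive term, all others
  being zero or positive, cannot vanish.

  It remains to justify the expansion. The untwisted products of power sums are linearly independent,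
  because their coefficients form a triangular matrix with nonzero diagonal with respect to the sum of
  the squares of the exponents of a monomial; the twisted ones span the same finite-dimensional pieces
  and are equally many, so they are independent too. A Schur function is symmetric under adjacent
  transpositions by the Bender--Knuth involution, and a series with this symmetry is determined by its
  coefficients at the monomials with weakly decreasing exponents, at which a combination of power sum
  products can take any prescribed values. Hence Schur functions are polynomials in power sums, which
  also shows that they are invariant under all permutations of the variables.
\<close>

section \<open>Positivity in the field of rational functions\<close>

text \<open>The coefficient of the lexicographically largest monomial, powers of \<open>t\<close> counting before
  powers of \<open>q\<close>.\<close>

definition lead_coeff2 :: "complex poly poly \<Rightarrow> complex" where
  "lead_coeff2 p = lead_coeff (lead_coeff p)"

lemma lead_coeff2_mult: "lead_coeff2 (p * r) = lead_coeff2 p * lead_coeff2 r"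
  by (simp add: lead_coeff2_def lead_coeff_mult)

lemma lead_coeff2_eq_0_iff [simp]: "lead_coeff2 p = 0 \<longleftrightarrow> p = 0"
  by (simp add: lead_coeff2_def)

text \<open>If the degrees differ, the polynomial of larger degree decides; if they agree, the leading
  coefficients add up.\<close>

lemma lead_coeff_add_cases:
  "lead_coeff (p + r) \<in> {lead_coeff p, lead_coeff r, lead_coeff p + lead_coeff r}"
  if "lead_coeff p + lead_coeff r \<noteq> 0"
proof (cases "degree p" "degree r" rule: linorder_cases)
  case equal
  have "coeff (p + r) (degree p) \<noteq> 0" using that equal by simp
  then have "degree p \<le> degree (p + r)" by (rule le_degree)
  moreover have "degree (p + r) \<le> degree p" using equal by (intro degree_add_le) auto
  ultimately show ?thesis using equal by simp
next
  case less
  then show ?thesis using lead_coeff_add_le[OF less] by blast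
next
  case greater
  then show ?thesis using lead_coeff_add_le[OF greater] by (metis add.commute insertI1)
qed

definition pos_real :: "complex \<Rightarrow> bool" where
  "pos_real z \<longleftrightarrow> z \<in> \<real> \<and> Re z > 0"

definition pos2 :: "complex poly poly \<Rightarrow> bool" where
  "pos2 p \<longleftrightarrow> pos_real (lead_coeff2 p)"

lemma pos_real_simps:
  "pos_real a \<Longrightarrow> pos_real b \<Longrightarrow> pos_real (a + b)"
  "pos_real a \<Longrightarrow> pos_real b \<Longrightarrow> pos_real (a * b)"
  "\<not> pos_real 0"
  by (auto simp: pos_real_def elim!: Reals_cases)

text \<open>Two leading coefficients on the same open ray cannot cancel, on the level of \<open>t\<close> as little as
  on the level of \<open>q\<close>.\<close>

lemma pos2_add:
  assumes "pos2 p" "pos2 r"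
  shows "pos2 (p + r)"
proof (cases "lead_coeff p + lead_coeff r = 0")
  case True
  then have "lead_coeff (lead_coeff r) = - lead_coeff (lead_coeff p)"
    by (metis add_eq_0_iff lead_coeff_minus)
  then have "pos_real (lead_coeff (lead_coeff p) + - lead_coeff (lead_coeff p))"
    using assms pos_real_simps(1)[of "lead_coeff2 p" "lead_coeff2 r"] by (simp add: pos2_def lead_coeff2_def)
  then show ?thesis using pos_real_simps(3) by simp
next
  case False
  define a b where "a = lead_coeff p" and "b = lead_coeff r"
  have ab: "pos_real (lead_coeff a)" "pos_real (lead_coeff b)"
    using assms by (auto simp: pos2_def lead_coeff2_def a_def b_def)
  have "lead_coeff a + lead_coeff b \<noteq> 0" using pos_real_simps(1)[OF ab] pos_real_simps(3) by auto
  from lead_coeff_add_cases[OF this] have "pos_real (lead_coeff (a + b))"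
    using ab pos_real_simps(1)[OF ab] by (metis empty_iff insert_iff)
  moreover have "lead_coeff (p + r) \<in> {a, b, a + b}"
    using lead_coeff_add_cases[OF False] by (simp only: a_def b_def)
  ultimately show ?thesis using ab unfolding pos2_def lead_coeff2_def by (metis empty_iff insert_iff)
qed

text \<open>The leading coefficients \<open>u\<close> and \<open>v\<close> of numerator and denominator have a positive quotient if and
  only if \<open>u \<cdot> cnj v\<close> is positive, which is stated here without dividing.\<close>

definition F_pos :: "F \<Rightarrow> bool" where
  "F_pos x \<longleftrightarrow> (\<exists>a b. b \<noteq> 0 \<and> x = Fract a b \<and> pos2 (a * cnj_poly2 b))"

lemma lead_coeff2_cnj: "lead_coeff2 (cnj_poly2 p) = cnj (lead_coeff2 p)"
proof -
  have "degree (map_poly cnj q) = degree q" for q by (rule degree_map_poly) simp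
  moreover have "degree (cnj_poly2 p) = degree p"
    unfolding cnj_poly2_def by (rule degree_map_poly) (simp add: map_poly_cnj_eq_0_iff)
  ultimately show ?thesis by (simp add: lead_coeff2_def) (simp add: cnj_poly2_def coeff_map_poly)
qed

lemma pos_real_mult_cnj: "z \<noteq> 0 \<Longrightarrow> pos_real (z * cnj z)"
  by (simp add: pos_real_def complex_mult_cnj) (simp add: complex_eq_iff sum_power2_gt_zero_iff)

lemma pos2_mult: "pos2 p \<Longrightarrow> pos2 r \<Longrightarrow> pos2 (p * r)"
  by (simp add: pos2_def lead_coeff2_mult pos_real_simps)

lemma cnj_poly2_add: "cnj_poly2 (p + r) = cnj_poly2 p + cnj_poly2 r"
  unfolding cnj_poly2_def by (intro map_poly_add_hom) simp_all

lemma cnj_poly2_cnj_poly2 [simp]: "cnj_poly2 (cnj_poly2 p) = p"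
  by (simp add: cnj_poly2_def poly_eq_iff coeff_map_poly)

lemma F_cnj_Fract: "b \<noteq> 0 \<Longrightarrow> F_cnj (Fract a b) = Fract (cnj_poly2 a) (cnj_poly2 b)"
  by transfer auto

lemma F_cnj_add: "F_cnj (x + y) = F_cnj x + F_cnj y"
  by (cases x; cases y) (simp add: F_cnj_Fract cnj_poly2_add cnj_poly2_mult)

lemma F_cnj_mult: "F_cnj (x * y) = F_cnj x * F_cnj y"
  by (cases x; cases y) (simp add: F_cnj_Fract cnj_poly2_mult)

lemma F_cnj_F_cnj: "F_cnj (F_cnj x) = x"
  by (cases x) (simp add: F_cnj_Fract)

lemma pos2_mult_cnj: "p \<noteq> 0 \<Longrightarrow> pos2 (p * cnj_poly2 p)"
  by (simp add: pos2_def lead_coeff2_mult lead_coeff2_cnj pos_real_mult_cnj)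

lemma F_pos_add:
  assumes "F_pos x" "F_pos y"
  shows "F_pos (x + y)"
proof -
  obtain a b c d where x: "b \<noteq> 0" "x = Fract a b" "pos2 (a * cnj_poly2 b)"
    and y: "d \<noteq> 0" "y = Fract c d" "pos2 (c * cnj_poly2 d)"
    using assms unfolding F_pos_def by metis
  have "pos2 ((a * cnj_poly2 b) * (d * cnj_poly2 d) + (c * cnj_poly2 d) * (b * cnj_poly2 b))"
    using pos2_add[OF pos2_mult pos2_mult] pos2_mult_cnj x y by blast
  then have "pos2 ((a * d + c * b) * cnj_poly2 (b * d))"
    by (simp add: cnj_poly2_mult algebra_simps)
  then show ?thesis
    using x y unfolding F_pos_def by (intro exI[of _ "a * d + c * b"] exI[of _ "b * d"]) auto
qed

lemma F_pos_mult:
  assumes "F_pos x" "F_pos y"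
  shows "F_pos (x * y)"
proof -
  obtain a b c d where x: "b \<noteq> 0" "x = Fract a b" "pos2 (a * cnj_poly2 b)"
    and y: "d \<noteq> 0" "y = Fract c d" "pos2 (c * cnj_poly2 d)"
    using assms unfolding F_pos_def by metis
  have "pos2 ((a * cnj_poly2 b) * (c * cnj_poly2 d))"
    using pos2_mult x(3) y(3) by blast
  then have "pos2 ((a * c) * cnj_poly2 (b * d))"
    by (simp add: cnj_poly2_mult algebra_simps)
  then show ?thesis
    using x y unfolding F_pos_def by (intro exI[of _ "a * c"] exI[of _ "b * d"]) auto
qed

lemma F_pos_not_0: "\<not> F_pos 0"
  by (auto simp: F_pos_def Zero_fract_def eq_fract pos2_def lead_coeff2_def pos_real_simps)

lemma F_pos_mult_cnj:
  assumes "x \<noteq> 0"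
  shows "F_pos (x * F_cnj x)"
proof (cases x)
  case (Fract a b)
  then have ab: "a \<noteq> 0" "b \<noteq> 0" using assms by (auto simp: fract_collapse)
  have "pos2 ((a * cnj_poly2 a) * (b * cnj_poly2 b))"
    using ab by (intro pos2_mult pos2_mult_cnj)
  then have "pos2 ((a * cnj_poly2 a) * cnj_poly2 (b * cnj_poly2 b))"
    by (simp add: cnj_poly2_mult mult_ac)
  then show ?thesis unfolding F_pos_def using Fract ab
    by (intro exI[of _ "a * cnj_poly2 a"] exI[of _ "b * cnj_poly2 b"]) (auto simp: F_cnj_Fract)
qed

lemma F_pos_sum:
  assumes "finite A" "A \<noteq> {}" "\<And>a. a \<in> A \<Longrightarrow> F_pos (f a)"
  shows "F_pos (sum f A)"
  using assms by (induction A rule: finite_ne_induct) (auto intro: F_pos_add)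

lemma F_pos_1: "F_pos 1"
  unfolding One_fract_def F_pos_def
  by (intro exI[of _ 1]) (auto simp: pos2_def lead_coeff2_mult lead_coeff2_cnj, auto simp: lead_coeff2_def pos_real_def)

lemma F_pos_prod: "(\<And>a. a \<in> A \<Longrightarrow> F_pos (f a)) \<Longrightarrow> F_pos (prod f A)"
  by (induction A rule: infinite_finite_induct) (auto intro: F_pos_mult F_pos_1)

lemma F_pos_of_nat: "n > 0 \<Longrightarrow> F_pos (of_nat n)"
proof (induction n)
  case (Suc n)
  then show ?case by (cases "n = 0") (auto intro: F_pos_add F_pos_1)
qed simp

text \<open>Numerator and denominator have the same leading coefficient \<open>- c\<close>, one at \<open>q\<^sup>r\<close>, the other at
  \<open>t\<^sup>r\<close>.\<close>

lemma F_pos_quotient: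
  assumes "c \<noteq> 0" "r > 0"
  shows "F_pos ((1 - F_const c * F_q ^ r) / (1 - F_const c * F_t ^ r))"
proof -
  have q: "F_q ^ r = Fract [:monom 1 r:] 1"
  proof (induction r)
    case 0 show ?case by (simp add: One_fract_def pCons_one monom_0 flip: one_pCons)
  next
    case (Suc r) then show ?case by (simp add: F_q_def monom_Suc)
  qed
  have t: "F_t ^ r = Fract (monom 1 r) 1"
  proof (induction r)
    case 0 show ?case by (simp add: One_fract_def monom_0 flip: one_pCons)
  next
    case (Suc r) then show ?case by (simp add: F_t_def monom_Suc)
  qed
  define a where "a = (1 :: complex poly poly) - [:monom c r:]"
  define b where "b = (1 :: complex poly poly) - monom [:c:] r"
  have A: "1 - F_const c * F_q ^ r = Fract a 1"
    unfolding q F_const_def One_fract_def by (simp add: a_def smult_monom)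
  have B: "1 - F_const c * F_t ^ r = Fract b 1"
    unfolding t F_const_def One_fract_def by (simp add: b_def smult_monom)
  have lead: "lead_coeff (1 - monom d r) = - d" if "d \<noteq> 0" for d :: "'a :: comm_ring_1"
  proof -
    have "degree (1 :: 'a poly) < degree (- monom d r)" using that assms by (simp add: degree_monom_eq)
    from lead_coeff_add_le[OF this] show ?thesis
      using that by (simp add: lead_coeff_minus degree_monom_eq)
  qed
  have "a = [:1 - monom c r:]" by (simp add: a_def one_pCons)
  then have la: "lead_coeff2 a = - c" using lead[OF assms(1)] by (simp add: lead_coeff2_def)
  have lb: "lead_coeff2 b = - c" using lead[of "[:c:]"] assms unfolding lead_coeff2_def b_def by simp
  have "b \<noteq> 0" using lb assms by (metis lead_coeff2_eq_0_iff neg_equal_0_iff_equal)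
  then show ?thesis unfolding A B F_pos_def
    using assms la lb by (intro exI[of _ a] exI[of _ b])
      (auto simp: pos2_def lead_coeff2_mult lead_coeff2_cnj dest: pos_real_mult_cnj)
qed

lemma z_part_pos: "z_part l > 0"
  unfolding z_part_def by (cases "finite (range l - {0})") (auto intro!: prod_pos)

lemma F_pos_z_qt:
  assumes "primitive_root_of_unity e \<zeta>"
  shows "F_pos (z_qt e \<zeta> \<alpha>)"
proof -
  have "e > 0" "\<zeta> \<noteq> 0" using assms by (auto simp: primitive_root_of_unity_def power_0_left split: if_splits)
  then have "z_ep e \<alpha> > 0" using z_part_pos by (simp add: z_ep_def prod_pos)
  then show ?thesis unfolding z_qt_def
    using \<open>\<zeta> \<noteq> 0\<close> by (intro F_pos_mult F_pos_of_nat F_pos_prod F_pos_quotient) auto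
qed

section \<open>Dual block-triangular families for an anisotropic form\<close>

text \<open>A form that is linear in the first variable, semilinear with respect to an involution in the
  second, and takes the value 0 at no pair \<open>(x, x)\<close> with \<open>x \<noteq> 0\<close>.\<close>

locale anisotropic_form = vector_space scale
  for scale :: "'a::field \<Rightarrow> 'b::ab_group_add \<Rightarrow> 'b" (infixr "*s" 75) +
  fixes W :: "'b set" and B :: "'b \<Rightarrow> 'b \<Rightarrow> 'a" and \<sigma> :: "'a \<Rightarrow> 'a"
  assumes subspace_W: "subspace W"
    and add_left: "\<lbrakk>x \<in> W; y \<in> W; z \<in> W\<rbrakk> \<Longrightarrow> B (x + y) z = B x z + B y z"
    and add_right: "\<lbrakk>x \<in> W; y \<in> W; z \<in> W\<rbrakk> \<Longrightarrow> B x (y + z) = B x y + B x z"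
    and scale_left: "\<lbrakk>x \<in> W; y \<in> W\<rbrakk> \<Longrightarrow> B (c *s x) y = c * B x y"
    and scale_right: "\<lbrakk>x \<in> W; y \<in> W\<rbrakk> \<Longrightarrow> B x (c *s y) = \<sigma> c * B x y"
    and \<sigma>_add: "\<sigma> (a + b) = \<sigma> a + \<sigma> b"
    and \<sigma>_mult: "\<sigma> (a * b) = \<sigma> a * \<sigma> b"
    and \<sigma>_\<sigma>: "\<sigma> (\<sigma> a) = a"
    and anisotropic: "\<lbrakk>x \<in> W; B x x = 0\<rbrakk> \<Longrightarrow> x = 0"
begin

lemma \<sigma>_eq_0_iff: "\<sigma> a = 0 \<longleftrightarrow> a = 0"
  by (metis \<sigma>_add \<sigma>_\<sigma> add_cancel_right_right)

text \<open>Passing to the adjoint form exchanges left and right, so that every statement about left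
  orthogonality also gives the one about right orthogonality.\<close>

lemma adjoint_form: "anisotropic_form scale W (\<lambda>x y. \<sigma> (B y x)) \<sigma>"
  by unfold_locales
    (auto simp: subspace_W add_left add_right scale_left scale_right \<sigma>_add \<sigma>_mult \<sigma>_\<sigma> \<sigma>_eq_0_iff
      intro: anisotropic)

lemma orthogonal_span_right:
  assumes "x \<in> W" "S \<subseteq> W" "\<And>s. s \<in> S \<Longrightarrow> B x s = 0" "y \<in> span S"
  shows "B x y = 0"
proof -
  have "y \<in> W \<and> B x y = 0" using assms(4)
  proof (induction rule: span_induct_alt)
    case base
    have "B x (0 *s x) = \<sigma> 0 * B x x" by (rule scale_right[OF assms(1) assms(1)])
    then show ?case using \<sigma>_eq_0_iff[of 0] subspace_0[OF subspace_W] by simp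
  next
    case (step c z y)
    have "z \<in> W" "c *s z \<in> W"
      using step.hyps assms(2) subspace_scale[OF subspace_W] by auto
    then show ?case
      using step assms subspace_add[OF subspace_W] by (simp add: add_right scale_right)
  qed
  then show ?thesis by simp
qed

text \<open>Gram--Schmidt, one generator at a time. A new generator \<open>s\<close> is first made left orthogonal to the
  old span; the result \<open>s'\<close> generates the same larger span, and its multiple in \<open>x\<close> is removed by
  dividing by \<open>B s' s'\<close>, which anisotropy allows.\<close>

lemma projection_exists:
  assumes "finite S" "S \<subseteq> W" "x \<in> W"
  shows "\<exists>v \<in> span S. \<forall>w \<in> span S. B (x + v) w = 0"
  using assms
proof (induction S arbitrary: x rule: finite_induct)
  case empty
  then show ?case
    using orthogonal_span_right[of x "{}"] by auto
next
  case (insert s S)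
  have sW: "s \<in> W" and SW: "S \<subseteq> W" using insert.prems by auto
  have spW: "span S \<subseteq> W" by (rule span_minimal[OF SW subspace_W])
  obtain v0 where v0: "v0 \<in> span S" "\<And>w. w \<in> span S \<Longrightarrow> B (s + v0) w = 0"
    using insert.IH[OF SW sW] by auto
  obtain v1 where v1: "v1 \<in> span S" "\<And>w. w \<in> span S \<Longrightarrow> B (x + v1) w = 0"
    using insert.IH[OF SW insert.prems(2)] by auto
  define s' where "s' = s + v0"
  define x1 where "x1 = x + v1"
  have W: "v0 \<in> W" "v1 \<in> W" "s' \<in> W" "x1 \<in> W"
    using v0(1) v1(1) spW sW insert.prems(2) subspace_add[OF subspace_W]
    by (auto simp: s'_def x1_def)
  have sp': "span (insert s S) = span (insert s' S)"
  proof -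
    have "span S \<subseteq> span (insert a S)" for a by (rule span_mono) auto
    then have v0': "v0 \<in> span (insert a S)" for a using v0(1) by blast
    have "s' \<in> span (insert s S)"
      unfolding s'_def by (rule span_add[OF span_base v0']) simp
    moreover have "s' - v0 \<in> span (insert s' S)"
      by (rule span_diff[OF span_base v0']) simp
    then have "s \<in> span (insert s' S)" by (simp add: s'_def)
    ultimately have "insert s S \<subseteq> span (insert s' S)" "insert s' S \<subseteq> span (insert s S)"
      by (auto intro: span_base)
    then show ?thesis by (intro equalityI span_minimal) auto
  qed
  \<comment> \<open>the default \<open>x / 0 = 0\<close> makes this right also if \<open>s'\<close> is zero\<close>
  define c where "c = B x1 s' / B s' s'"
  have cs: "c *s s' \<in> W" "(- c) *s s' \<in> W"
    using W subspace_scale[OF subspace_W] by blast+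
  define y where "y = x1 + (- c) *s s'"
  have yW: "y \<in> W" unfolding y_def using subspace_add[OF subspace_W W(4) cs(2)] .
  have "B y w = 0" if "w \<in> insert s' S" for w
  proof (cases "w \<in> S")
    case True
    then have w: "w \<in> span S" "w \<in> W" using SW by (auto intro: span_base)
    have "B x1 w = 0" "B s' w = 0" unfolding x1_def s'_def using v0(2) v1(2) w by auto
    then show ?thesis
      unfolding y_def by (simp only: add_left scale_left W cs w) simp
  next
    case False
    then have w: "w = s'" using that by simp
    show ?thesis
    proof (cases "s' = 0")
      case True
      then show ?thesis using w orthogonal_span_right[OF yW, of "{}" 0] by simp
    next
      case False
      then have "B s' s' \<noteq> 0" using anisotropic W by blast
      then show ?thesis
        unfolding y_def w by (simp only: add_left scale_left W cs) (simp add: c_def)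
    qed
  qed
  then have "\<forall>w\<in>span (insert s S). B y w = 0"
    unfolding sp' using orthogonal_span_right[OF yW, of "insert s' S"] W(3) SW by simp
  moreover have "v1 - c *s s' \<in> span (insert s S)"
    unfolding sp' using span_mono[of S "insert s' S"] v1(1)
    by (intro span_diff span_scale) (auto intro: span_base)
  moreover have "y = x + (v1 - c *s s')" by (simp add: y_def x1_def)
  ultimately show ?case by (intro bexI[of _ "v1 - c *s s'"]) simp_all
qed

text \<open>The difference of two projections lies in the span and is orthogonal to it, hence to itself.\<close>

lemma projection_unique:
  assumes "S \<subseteq> W" "x \<in> W" "y \<in> W" "x - y \<in> span S"
    and "\<And>w. w \<in> span S \<Longrightarrow> B x w = 0" "\<And>w. w \<in> span S \<Longrightarrow> B y w = 0"
  shows "x = y"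
proof -
  have d: "x - y \<in> W" by (rule subspace_diff[OF subspace_W assms(2,3)])
  have "B x (x - y) = B ((x - y) + y) (x - y)" by simp
  also have "\<dots> = B (x - y) (x - y) + B y (x - y)" using d assms(3) by (subst add_left) auto
  finally have "B (x - y) (x - y) = 0" using assms(4-6) by simp
  then show ?thesis using anisotropic[OF d] by simp
qed

end

text \<open>In the application \<open>s\<close> is the family of Schur functions and the classes of \<open>\<approx>\<close> are the families of
  symbols.\<close>

locale block_triangular = anisotropic_form scale W B \<sigma>
  for scale :: "'a::field \<Rightarrow> 'b::ab_group_add \<Rightarrow> 'b" (infixr "*s" 75) and W B \<sigma> +
  fixes Z :: "'i set" and less :: "'i \<Rightarrow> 'i \<Rightarrow> bool" (infix "\<sqsubset>" 50)
    and sim :: "'i \<Rightarrow> 'i \<Rightarrow> bool" (infix "\<approx>" 50) and s :: "'i \<Rightarrow> 'b"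
  assumes finite_Z: "finite Z"
    and less_Z: "\<alpha> \<sqsubset> \<beta> \<Longrightarrow> \<alpha> \<in> Z \<and> \<beta> \<in> Z"
    and less_irrefl: "\<not> \<alpha> \<sqsubset> \<alpha>"
    and less_trans: "\<alpha> \<sqsubset> \<beta> \<Longrightarrow> \<beta> \<sqsubset> \<gamma> \<Longrightarrow> \<alpha> \<sqsubset> \<gamma>"
    and less_total: "\<lbrakk>\<alpha> \<in> Z; \<beta> \<in> Z; \<alpha> \<noteq> \<beta>\<rbrakk> \<Longrightarrow> \<alpha> \<sqsubset> \<beta> \<or> \<beta> \<sqsubset> \<alpha>"
    and sim_refl: "\<alpha> \<approx> \<alpha>"
    and sim_sym: "\<alpha> \<approx> \<beta> \<Longrightarrow> \<beta> \<approx> \<alpha>"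
    and sim_trans: "\<alpha> \<approx> \<beta> \<Longrightarrow> \<beta> \<approx> \<gamma> \<Longrightarrow> \<alpha> \<approx> \<gamma>"
    and sim_interval: "\<lbrakk>\<alpha> \<sqsubset> \<beta>; \<beta> \<sqsubset> \<gamma>; \<alpha> \<approx> \<gamma>\<rbrakk> \<Longrightarrow> \<alpha> \<approx> \<beta>"
    and s_W: "\<alpha> \<in> Z \<Longrightarrow> s \<alpha> \<in> W"
begin

definition lower :: "'i \<Rightarrow> 'i set" where
  "lower \<alpha> = {\<beta>. \<beta> \<sqsubset> \<alpha> \<and> \<not> \<beta> \<approx> \<alpha>}"

definition unitriangular :: "('i \<Rightarrow> 'b) \<Rightarrow> bool" where
  "unitriangular P \<longleftrightarrow> (\<forall>\<alpha>\<in>Z. P \<alpha> - s \<alpha> \<in> span (s ` lower \<alpha>))"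

lemma adjoint_block: "block_triangular scale W (\<lambda>x y. \<sigma> (B y x)) \<sigma> Z less sim s"
  by (intro block_triangular.intro adjoint_form block_triangular_axioms.intro)
    (fact finite_Z less_Z less_irrefl less_trans less_total sim_refl sim_sym sim_trans
      sim_interval s_W)+

lemma lower_Z: "lower \<alpha> \<subseteq> Z"
  using less_Z by (auto simp: lower_def)

text \<open>If \<open>\<gamma> \<sqsubset> \<beta> \<sqsubset> \<alpha>\<close> and \<open>\<gamma>\<close> were equivalent to \<open>\<alpha>\<close>, then \<open>\<gamma>\<close> would be equivalent to \<open>\<beta>\<close>, because
  classes are intervals. But \<open>\<gamma> \<in> lower \<beta>\<close> excludes this.\<close>

lemma lower_mono: "\<beta> \<in> lower \<alpha> \<Longrightarrow> lower \<beta> \<subseteq> lower \<alpha>"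
  unfolding lower_def using less_trans sim_interval by blast

lemma lower_cases:
  assumes "\<alpha> \<in> Z" "\<beta> \<in> Z" "\<not> \<alpha> \<approx> \<beta>"
  shows "\<alpha> \<in> lower \<beta> \<or> \<beta> \<in> lower \<alpha>"
  using assms less_total[OF assms(1,2)] sim_refl sim_sym by (auto simp: lower_def)

lemma lower_W: "s ` lower \<alpha> \<subseteq> W"
  using lower_Z s_W by auto

lemma unitriangular_W:
  assumes "unitriangular P" "\<alpha> \<in> Z"
  shows "P \<alpha> \<in> W"
proof -
  have "P \<alpha> - s \<alpha> \<in> W"
    using assms span_minimal[OF lower_W subspace_W] by (auto simp: unitriangular_def)
  then show ?thesis
    using subspace_add[OF subspace_W _ s_W[OF assms(2)]] by fastforce
qed

lemma unitriangular_span: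
  assumes "unitriangular P" "\<beta> \<in> lower \<alpha>"
  shows "P \<beta> \<in> span (s ` lower \<alpha>)"
proof -
  have "P \<beta> - s \<beta> \<in> span (s ` lower \<alpha>)"
    using assms lower_Z span_mono[OF image_mono[OF lower_mono[OF assms(2)]], of s]
    by (auto simp: unitriangular_def)
  moreover have "s \<beta> \<in> span (s ` lower \<alpha>)" using assms(2) by (auto intro: span_base)
  ultimately show ?thesis using span_add by fastforce
qed

text \<open>A unitriangular change of generators can be inverted step by step, starting at the bottom of
  the order.\<close>

lemma span_unitriangular:
  assumes P: "unitriangular P"
  shows "span (P ` lower \<alpha>) = span (s ` lower \<alpha>)"
proof
  show "span (P ` lower \<alpha>) \<subseteq> span (s ` lower \<alpha>)"
    using unitriangular_span[OF P] by (intro span_minimal) auto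
  have "s \<beta> \<in> span (P ` lower \<alpha>)" if "\<beta> \<in> lower \<alpha>" for \<beta>
    using that
  proof (induction "card (lower \<beta>)" arbitrary: \<beta> rule: less_induct)
    case less
    have "s \<gamma> \<in> span (P ` lower \<alpha>)" if \<gamma>: "\<gamma> \<in> lower \<beta>" for \<gamma>
    proof (rule less.hyps)
      have "\<gamma> \<notin> lower \<gamma>" by (simp add: lower_def less_irrefl)
      then have "lower \<gamma> \<subset> lower \<beta>" using lower_mono[OF \<gamma>] \<gamma> by blast
      then show "card (lower \<gamma>) < card (lower \<beta>)"
        using finite_subset[OF lower_Z finite_Z] by (intro psubset_card_mono)
      show "\<gamma> \<in> lower \<alpha>" using lower_mono[OF less.prems] \<gamma> by blast
    qed
    then have "span (s ` lower \<beta>) \<subseteq> span (P ` lower \<alpha>)" by (intro span_minimal) auto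
    moreover have "P \<beta> - s \<beta> \<in> span (s ` lower \<beta>)"
      using P less.prems lower_Z by (auto simp: unitriangular_def)
    moreover have "P \<beta> \<in> span (P ` lower \<alpha>)" using less.prems by (auto intro: span_base)
    ultimately have "P \<beta> - (P \<beta> - s \<beta>) \<in> span (P ` lower \<alpha>)" by (blast intro: span_diff)
    then show ?case by simp
  qed
  then show "span (s ` lower \<alpha>) \<subseteq> span (P ` lower \<alpha>)" 
    by (intro span_minimal) auto
qed

definition left_orthogonal :: "('i \<Rightarrow> 'b) \<Rightarrow> bool" where
  "left_orthogonal P \<longleftrightarrow> (\<forall>\<alpha>\<in>Z. \<forall>w\<in>span (s ` lower \<alpha>). B (P \<alpha>) w = 0)"

lemma left_orthogonal_exists: "\<exists>P. unitriangular P \<and> left_orthogonal P"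
proof -
  have "\<exists>p. p - s \<alpha> \<in> span (s ` lower \<alpha>) \<and> (\<forall>w\<in>span (s ` lower \<alpha>). B p w = 0)"
    if a: "\<alpha> \<in> Z" for \<alpha>
  proof -
    have "finite (s ` lower \<alpha>)" using finite_subset[OF lower_Z finite_Z] by blast
    from projection_exists[OF this lower_W s_W[OF a]] obtain v
      where "v \<in> span (s ` lower \<alpha>)" "\<forall>w\<in>span (s ` lower \<alpha>). B (s \<alpha> + v) w = 0" by blast
    then show ?thesis by (intro exI[of _ "s \<alpha> + v"]) auto
  qed
  then show ?thesis unfolding unitriangular_def left_orthogonal_def by metis
qed

lemma left_orthogonal_unique:
  assumes "unitriangular P" "left_orthogonal P" "unitriangular Q" "left_orthogonal Q" "\<alpha> \<in> Z"
  shows "P \<alpha> = Q \<alpha>"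
proof (rule projection_unique[OF lower_W])
  have "P \<alpha> - s \<alpha> - (Q \<alpha> - s \<alpha>) \<in> span (s ` lower \<alpha>)"
    using assms(1,3,5) by (intro span_diff[of "P \<alpha> - s \<alpha>"]) (simp_all add: unitriangular_def)
  then show "P \<alpha> - Q \<alpha> \<in> span (s ` lower \<alpha>)" by simp
qed (use assms unitriangular_W in \<open>auto simp: left_orthogonal_def\<close>)

definition dual_pair :: "('i \<Rightarrow> 'b) \<Rightarrow> ('i \<Rightarrow> 'b) \<Rightarrow> bool" where
  "dual_pair P Q \<longleftrightarrow> unitriangular P \<and> unitriangular Q \<and>
     (\<forall>\<alpha>\<in>Z. \<forall>\<beta>\<in>Z. \<not> \<alpha> \<approx> \<beta> \<longrightarrow> B (P \<alpha>) (Q \<beta>) = 0)"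

text \<open>\<open>P \<alpha>\<close> is orthogonal to the \<open>Q \<beta>\<close> with \<open>\<beta> \<in> lower \<alpha>\<close>, and these generate the same subspace as the
  corresponding \<open>s \<beta>\<close>.\<close>

lemma dual_pair_left_orthogonal:
  assumes "dual_pair P Q"
  shows "left_orthogonal P"
  unfolding left_orthogonal_def
proof (intro ballI)
  fix \<alpha> w assume a: "\<alpha> \<in> Z" and w: "w \<in> span (s ` lower \<alpha>)"
  have P: "unitriangular P" and Q: "unitriangular Q" using assms by (auto simp: dual_pair_def)
  show "B (P \<alpha>) w = 0"
  proof (rule orthogonal_span_right[OF unitriangular_W[OF P a]])
    show "w \<in> span (Q ` lower \<alpha>)" using w span_unitriangular[OF Q] by simp
    show "Q ` lower \<alpha> \<subseteq> W" using unitriangular_W[OF Q] lower_Z by auto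
    show "B (P \<alpha>) v = 0" if v: "v \<in> Q ` lower \<alpha>" for v
    proof -
      obtain \<beta> where \<beta>: "\<beta> \<sqsubset> \<alpha>" "\<not> \<beta> \<approx> \<alpha>" "v = Q \<beta>" using v by (auto simp: lower_def)
      have "\<not> \<alpha> \<approx> \<beta>" using sim_sym[of \<alpha> \<beta>] \<beta>(2) by blast
      then show ?thesis using assms a less_Z[OF \<beta>(1)] unfolding \<beta>(3) dual_pair_def by blast
    qed
  qed
qed

lemma dual_pair_adjoint:
  assumes "dual_pair P Q"
  shows "block_triangular.dual_pair scale (\<lambda>x y. \<sigma> (B y x)) Z less sim s Q P"
proof -
  interpret adj: block_triangular scale W "\<lambda>x y. \<sigma> (B y x)" \<sigma> Z less sim s
    by (rule adjoint_block)
  show ?thesis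
    unfolding adj.dual_pair_def \<sigma>_eq_0_iff
  proof (intro conjI ballI impI)
    show "unitriangular Q" "unitriangular P" using assms by (simp_all add: dual_pair_def)
    fix \<alpha> \<beta> assume "\<alpha> \<in> Z" "\<beta> \<in> Z" "\<not> \<alpha> \<approx> \<beta>"
    moreover from this(3) have "\<not> \<beta> \<approx> \<alpha>" using sim_sym[of \<beta> \<alpha>] by blast
    ultimately show "B (P \<beta>) (Q \<alpha>) = 0" using assms by (simp add: dual_pair_def)
  qed
qed

text \<open>Take the left projections for \<open>P\<close> and the right ones for \<open>Q\<close>. Of two inequivalent indices one is
  below the other, and the member at the larger one is orthogonal to all inequivalent members below.\<close>

theorem dual_pair_exists: "\<exists>P Q. dual_pair P Q"
proof -
  interpret adj: block_triangular scale W "\<lambda>x y. \<sigma> (B y x)" \<sigma> Z less sim s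
    by (rule adjoint_block)
  obtain P where P: "unitriangular P" "left_orthogonal P" using left_orthogonal_exists by blast
  obtain Q where Q: "unitriangular Q" "adj.left_orthogonal Q"
    using adj.left_orthogonal_exists by blast
  have "B (P \<alpha>) (Q \<beta>) = 0" if "\<alpha> \<in> Z" "\<beta> \<in> Z" "\<not> \<alpha> \<approx> \<beta>" for \<alpha> \<beta>
    using lower_cases[OF that]
  proof
    assume "\<alpha> \<in> lower \<beta>"
    then show ?thesis
      using Q(2) that unitriangular_span[OF P(1)] \<sigma>_eq_0_iff
      by (auto simp: adj.left_orthogonal_def)
  next
    assume "\<beta> \<in> lower \<alpha>"
    then show ?thesis
      using P(2) that unitriangular_span[OF Q(1)] by (auto simp: left_orthogonal_def)
  qed
  then have "dual_pair P Q" using P(1) Q(1) by (simp add: dual_pair_def)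
  then show ?thesis by blast
qed

theorem dual_pair_unique:
  assumes "dual_pair P Q" "dual_pair P' Q'" "\<alpha> \<in> Z"
  shows "P \<alpha> = P' \<alpha>" "Q \<alpha> = Q' \<alpha>"
proof -
  interpret adj: block_triangular scale W "\<lambda>x y. \<sigma> (B y x)" \<sigma> Z less sim s
    by (rule adjoint_block)
  have uni: "unitriangular P" "unitriangular P'" "unitriangular Q" "unitriangular Q'"
    using assms(1,2) by (simp_all add: dual_pair_def)
  show "P \<alpha> = P' \<alpha>"
    using uni dual_pair_left_orthogonal[OF assms(1)] dual_pair_left_orthogonal[OF assms(2)] assms(3)
    by (intro left_orthogonal_unique)
  show "Q \<alpha> = Q' \<alpha>"
    using uni assms(3)
      adj.dual_pair_left_orthogonal[OF dual_pair_adjoint[OF assms(1)]]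
      adj.dual_pair_left_orthogonal[OF dual_pair_adjoint[OF assms(2)]]
    by (intro adj.left_orthogonal_unique)
qed

end

section \<open>Products of power sums\<close>

lemma F_nonneg_sum:
  assumes "finite A" "\<And>a. a \<in> A \<Longrightarrow> f a = 0 \<or> F_pos (f a)"
  shows "sum f A = 0 \<or> F_pos (sum f A)" "sum f A = 0 \<longleftrightarrow> (\<forall>a\<in>A. f a = 0)"
proof -
  have "(sum f A = 0 \<or> F_pos (sum f A)) \<and> (sum f A = 0 \<longleftrightarrow> (\<forall>a\<in>A. f a = 0))"
    using assms
  proof (induction A rule: finite_induct)
    case (insert a A)
    then have IH: "sum f A = 0 \<or> F_pos (sum f A)" "sum f A = 0 \<longleftrightarrow> (\<forall>a\<in>A. f a = 0)" by auto
    from insert have "f a = 0 \<or> F_pos (f a)" by simp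
    then show ?case using IH insert.hyps
      by (metis F_pos_add F_pos_not_0 add.right_neutral add_0 insert_iff sum.insert)
  qed simp
  then show "sum f A = 0 \<or> F_pos (sum f A)" "sum f A = 0 \<longleftrightarrow> (\<forall>a\<in>A. f a = 0)" by auto
qed

lemma mcoeff_0 [simp]: "mcoeff 0 M = 0"
  by transfer simp

lemma mcoeff_1: "mcoeff 1 M = (if M = {#} then 1 else 0)"
  by transfer simp

lemma mcoeff_add [simp]: "mcoeff (f + g) M = mcoeff f M + mcoeff g M"
  by transfer simp

lemma mcoeff_diff [simp]: "mcoeff (f - g) M = mcoeff f M - mcoeff g M"
  by transfer simp

lemma mcoeff_scale [simp]: "mcoeff (mscale c f) M = c * mcoeff f M"
  by transfer simp

lemma mcoeff_sum: "mcoeff (\<Sum>a\<in>A. f a) M = (\<Sum>a\<in>A. mcoeff (f a) M)"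
  by (induction A rule: infinite_finite_induct) auto

lemma mcoeff_mult: "mcoeff (f * g) M = (\<Sum>(A, B)\<in>{(A, B). A + B = M}. mcoeff f A * mcoeff g B)"
  by transfer simp

lemma mscale_mult_left: "mscale c f * g = mscale c (f * g)"
  by (rule mseries_eqI) (simp add: mcoeff_mult sum_distrib_left case_prod_beta mult.assoc)

lemma mscale_mult_right: "f * mscale c g = mscale c (f * g)"
  by (metis mscale_mult_left mult.commute)

text \<open>Products of spans reduce to products of generators.\<close>

lemma span_mult:
  assumes "f \<in> mseries.span A" "g \<in> mseries.span B"
    and "\<And>a b. \<lbrakk>a \<in> A; b \<in> B\<rbrakk> \<Longrightarrow> a * b \<in> mseries.span C"
  shows "f * g \<in> mseries.span C"
proof -
  have *: "a * g \<in> mseries.span C" if "a \<in> A" for a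
    using assms(2)
  proof (induction rule: mseries.span_induct_alt)
    case base
    then show ?case by (simp add: mseries.span_zero)
  next
    case (step c x y)
    then show ?case using assms(3)[OF that]
      by (auto simp: distrib_left mscale_mult_right intro: mseries.span_add mseries.span_scale)
  qed
  show ?thesis using assms(1)
  proof (induction rule: mseries.span_induct_alt)
    case base
    then show ?case by (simp add: mseries.span_zero)
  next
    case (step c x y)
    then show ?case using *
      by (auto simp: distrib_right mscale_mult_left intro: mseries.span_add mseries.span_scale)
  qed
qed

text \<open>For series with such coefficients no cancellation can occur, so the monomials of a product are
  exactly the products of monomials of the factors.\<close>

definition nonneg_coeffs :: "series \<Rightarrow> bool" where
  "nonneg_coeffs f \<longleftrightarrow> (\<forall>M. mcoeff f M = 0 \<or> F_pos (mcoeff f M))"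

lemma nonneg_coeffs_mult:
  assumes "nonneg_coeffs f" "nonneg_coeffs g"
  shows "nonneg_coeffs (f * g)"
    and "mcoeff (f * g) M \<noteq> 0 \<longleftrightarrow> (\<exists>A B. M = A + B \<and> mcoeff f A \<noteq> 0 \<and> mcoeff g B \<noteq> 0)"
proof -
  have *: "mcoeff f A * mcoeff g B = 0 \<or> F_pos (mcoeff f A * mcoeff g B)" for A B
    using assms F_pos_mult by (metis nonneg_coeffs_def mult_eq_0_iff)
  have **: "(case x of (A, B) \<Rightarrow> mcoeff f A * mcoeff g B) = 0 \<or>
      F_pos (case x of (A, B) \<Rightarrow> mcoeff f A * mcoeff g B)" for x
    by (cases x) (simp only: prod.case *)
  note F = F_nonneg_sum[OF finite_splits, where f = "\<lambda>(A, B). mcoeff f A * mcoeff g B"]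
  show "nonneg_coeffs (f * g)"
    unfolding nonneg_coeffs_def mcoeff_mult by (intro allI F(1) **)
  have "mcoeff (f * g) M = 0 \<longleftrightarrow>
      (\<forall>x\<in>{(A, B). A + B = M}. (\<lambda>(A, B). mcoeff f A * mcoeff g B) x = 0)"
    unfolding mcoeff_mult by (intro F(2) **)
  then show "mcoeff (f * g) M \<noteq> 0 \<longleftrightarrow> (\<exists>A B. M = A + B \<and> mcoeff f A \<noteq> 0 \<and> mcoeff g B \<noteq> 0)"
    by auto
qed

lemma mcoeff_psum: "mcoeff (psum k r) M = (if \<exists>i. M = replicate_mset r (k, i) then 1 else 0)"
  by (simp add: psum_def MSeries_inverse)

text \<open>A product of power sums is indexed by the multiset of its factors, the pair \<open>(k, r)\<close> standing for
  the \<open>r\<close>-th power sum of the \<open>k\<close>-th alphabet.\<close>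

definition psum_prod :: "(nat \<times> nat) multiset \<Rightarrow> series" where
  "psum_prod X = (\<Prod>(k, r)\<in>#X. psum k r)"

lemma psum_prod_empty [simp]: "psum_prod {#} = 1"
  by (simp add: psum_prod_def)

lemma psum_prod_add_mset [simp]: "psum_prod (add_mset x X) = psum (fst x) (snd x) * psum_prod X"
  by (simp add: psum_prod_def case_prod_beta)

lemma nonneg_coeffs_psum: "nonneg_coeffs (psum k r)"
  by (simp add: nonneg_coeffs_def mcoeff_psum F_pos_1)

lemma nonneg_coeffs_psum_prod: "nonneg_coeffs (psum_prod X)"
proof (induction X)
  case empty
  then show ?case by (simp add: nonneg_coeffs_def mcoeff_1 F_pos_1)
next
  case (add x X)
  then show ?case by (simp add: nonneg_coeffs_mult nonneg_coeffs_psum)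
qed

lemma mcoeff_psum_prod_add_mset:
  "mcoeff (psum_prod (add_mset x X)) M \<noteq> 0 \<longleftrightarrow>
    (\<exists>i M'. M = replicate_mset (snd x) (fst x, i) + M' \<and> mcoeff (psum_prod X) M' \<noteq> 0)"
  unfolding psum_prod_add_mset
    nonneg_coeffs_mult(2)[OF nonneg_coeffs_psum nonneg_coeffs_psum_prod]
  by (auto simp: mcoeff_psum split: if_splits)

text \<open>The exponents of a monomial, each with the alphabet of its variable, but without its index. This
  is the index of a product of power sums.\<close>

definition shape :: "(nat \<times> nat) multiset \<Rightarrow> (nat \<times> nat) multiset" where
  "shape M = image_mset (\<lambda>v. (fst v, count M v)) (mset_set (set_mset M))"

text \<open>The sum of the squared exponents, which strictly grows when two exponents are added up.\<close>

definition energy :: "(nat \<times> nat) multiset \<Rightarrow> nat" where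
  "energy X = (\<Sum>(k, r)\<in>#X. r\<^sup>2)"

lemma energy_shape: "energy (shape M) = (\<Sum>v\<in>set_mset M. (count M v)\<^sup>2)"
  by (simp add: energy_def shape_def sum_unfold_sum_mset image_mset.compositionality comp_def)

lemma energy_shape_replicate:
  assumes "r > 0"
  shows "energy (shape (replicate_mset r v + M)) =
    energy (shape M) + r\<^sup>2 + 2 * r * count M v"
proof -
  let ?S = "set_mset M - {v}"
  have "energy (shape (replicate_mset r v + M)) = (r + count M v)\<^sup>2 + (\<Sum>u\<in>?S. (count M u)\<^sup>2)"
  proof -
    have "set_mset (replicate_mset r v + M) = insert v ?S" using assms by auto
    then show ?thesis unfolding energy_shape
      by (simp add: sum.insert_remove del: set_mset_union)
  qed
  moreover have "energy (shape M) = (count M v)\<^sup>2 + (\<Sum>u\<in>?S. (count M u)\<^sup>2)"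
    unfolding energy_shape
    by (cases "v \<in># M") (simp_all add: sum.remove not_in_iff[symmetric] count_eq_zero_iff)
  ultimately show ?thesis by (simp add: power2_sum)
qed

lemma shape_replicate:
  assumes "r > 0" "v \<notin># M"
  shows "shape (replicate_mset r v + M) = add_mset (fst v, r) (shape M)"
proof -
  have "set_mset (replicate_mset r v + M) = insert v (set_mset M)" using assms by auto
  moreover have "count M v = 0" using assms(2) by (simp add: count_eq_zero_iff)
  moreover have "image_mset (\<lambda>u. (fst u, count (replicate_mset r v + M) u)) (mset_set (set_mset M)) =
     image_mset (\<lambda>u. (fst u, count M u)) (mset_set (set_mset M))"
    using assms(2) by (intro image_mset_cong) auto
  ultimately show ?thesis
    using assms(2) by (simp add: shape_def)
qed

text \<open>A monomial of a product of power sums arises by choosing a variable for each factor. Exponents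
  add up when a variable is chosen repeatedly, and then the sum of squares strictly increases.\<close>

lemma psum_prod_triangular:
  assumes "mcoeff (psum_prod X) M \<noteq> 0" "\<And>x. x \<in># X \<Longrightarrow> snd x > 0"
  shows "energy X \<le> energy (shape M)" "energy (shape M) \<le> energy X \<Longrightarrow> shape M = X"
proof -
  have "energy X \<le> energy (shape M) \<and> (energy (shape M) \<le> energy X \<longrightarrow> shape M = X)"
    using assms
  proof (induction X arbitrary: M)
    case empty
    then show ?case by (simp add: mcoeff_1 shape_def energy_def split: if_splits)
  next
    case (add x X)
    then obtain i M' where M: "M = replicate_mset (snd x) (fst x, i) + M'"
        "mcoeff (psum_prod X) M' \<noteq> 0"
      using mcoeff_psum_prod_add_mset by blast
    have pos: "snd x > 0" using add.prems by simp
    have IH: "energy X \<le> energy (shape M')" "energy (shape M') \<le> energy X \<Longrightarrow> shape M' = X"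
      using add M by auto
    have eX: "energy (add_mset x X) = (snd x)\<^sup>2 + energy X" by (simp add: energy_def case_prod_beta)
    note eM = energy_shape_replicate[OF pos, of "(fst x, i)" M', folded M(1)]
    show ?case
    proof (intro conjI impI)
      assume "energy (shape M) \<le> energy (add_mset x X)"
      then have "2 * snd x * count M' (fst x, i) = 0" "energy (shape M') \<le> energy X"
        using IH(1) unfolding eX eM by linarith+
      then have "(fst x, i) \<notin># M'" "shape M' = X"
        using IH(2) pos by (auto simp: count_eq_zero_iff)
      then show "shape M = add_mset x X" using M(1) pos by (simp add: shape_replicate)
    qed (use IH(1) eX eM in linarith)
  qed
  then show "energy X \<le> energy (shape M)" "energy (shape M) \<le> energy X \<Longrightarrow> shape M = X"
    by (rule conjunct1, rule mp[OF conjunct2])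
qed

text \<open>Choosing for each factor the variable that it stems from gives back the monomial.\<close>

lemma mcoeff_psum_prod_shape: "mcoeff (psum_prod (shape M)) M \<noteq> 0"
proof (induction "size M" arbitrary: M rule: less_induct)
  case less
  show ?case
  proof (cases "M = {#}")
    case True
    then show ?thesis by (simp add: shape_def mcoeff_1)
  next
    case False
    then obtain v where v: "v \<in># M" by auto
    define M' where "M' = filter_mset (\<lambda>u. u \<noteq> v) M"
    have M: "M = replicate_mset (count M v) v + M'"
      by (rule multiset_eqI) (simp add: M'_def)
    have "v \<notin># M'" by (simp add: M'_def)
    then have shape: "shape M = add_mset (fst v, count M v) (shape M')"
      using shape_replicate[of "count M v" v M'] M v by simp
    have "size M' < size M"
      using v arg_cong[OF M, of size] by (simp flip: count_greater_zero_iff)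
    then have "mcoeff (psum_prod (shape M')) M' \<noteq> 0" by (rule less)
    then show ?thesis
      using M unfolding shape mcoeff_psum_prod_add_mset
      by (intro exI[of _ "snd v"] exI[of _ M']) simp
  qed
qed

lemma shape_surj:
  assumes "\<And>x. x \<in># X \<Longrightarrow> snd x > 0"
  obtains M where "shape M = X"
proof -
  have "\<exists>M. shape M = X" using assms
  proof (induction X)
    case empty
    show ?case by (intro exI[of _ "{#}"]) (simp add: shape_def)
  next
    case (add x X)
    then obtain M where M: "shape M = X" by auto
    obtain i where i: "i \<notin> snd ` set_mset M"
      using ex_new_if_finite[OF infinite_UNIV_nat, of "snd ` set_mset M"] by auto
    then have "(fst x, i) \<notin># M" by force
    then have "shape (replicate_mset (snd x) (fst x, i) + M) = add_mset x X"
      using add.prems M by (simp add: shape_replicate)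
    then show ?case by blast
  qed
  then show ?thesis using that by blast
qed

text \<open>Independence of a family rather than of a set, so that repeated members count as dependent.\<close>

definition lin_indep_family :: "('i \<Rightarrow> series) \<Rightarrow> 'i set \<Rightarrow> bool" where
  "lin_indep_family v A \<longleftrightarrow> (\<forall>c. (\<Sum>a\<in>A. mscale (c a) (v a)) = 0 \<longrightarrow> (\<forall>a\<in>A. c a = 0))"

text \<open>In a nontrivial relation consider a member \<open>v a\<close> of least rank that occurs: no other
  member of the relation has the monomial \<open>m a\<close>.\<close>

lemma triangular_independent:
  fixes rank :: "'i \<Rightarrow> nat"
  assumes "finite A" "\<And>a. a \<in> A \<Longrightarrow> mcoeff (v a) (m a) \<noteq> 0"
    and "\<And>a b. \<lbrakk>a \<in> A; b \<in> A; a \<noteq> b; mcoeff (v a) (m b) \<noteq> 0\<rbrakk> \<Longrightarrow> rank a < rank b"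
  shows "lin_indep_family v A"
  unfolding lin_indep_family_def
proof (intro allI impI, rule ccontr)
  fix c assume 0: "(\<Sum>a\<in>A. mscale (c a) (v a)) = 0" and "\<not> (\<forall>a\<in>A. c a = 0)"
  then have "\<exists>a. a \<in> A \<and> c a \<noteq> 0" by blast
  from exists_least_iff[of "\<lambda>n. \<exists>a. a \<in> A \<and> c a \<noteq> 0 \<and> rank a = n"] this
  obtain a where a: "a \<in> A" "c a \<noteq> 0"
    and min: "\<And>b. \<lbrakk>b \<in> A; c b \<noteq> 0\<rbrakk> \<Longrightarrow> rank a \<le> rank b"
    by (metis linorder_not_less)
  have "c b * mcoeff (v b) (m a) = 0" if "b \<in> A - {a}" for b
    using that min[of b] assms(3)[of b a] a(1) by force
  then have "(\<Sum>b\<in>A - {a}. c b * mcoeff (v b) (m a)) = 0" by (rule sum.neutral[OF ballI])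
  then have "(\<Sum>b\<in>A. c b * mcoeff (v b) (m a)) = c a * mcoeff (v a) (m a)"
    using sum.remove[OF assms(1) a(1), of "\<lambda>b. c b * mcoeff (v b) (m a)"] by simp
  moreover have "(\<Sum>b\<in>A. c b * mcoeff (v b) (m a)) = 0"
    using arg_cong[OF 0, of "\<lambda>f. mcoeff f (m a)"] by (simp add: mcoeff_sum)
  ultimately show False using a assms(2) by simp
qed

text \<open>The member of largest rank does not meet the monomials of the others, so it can be used last, to
  adjust the one remaining coefficient.\<close>

lemma triangular_solve:
  fixes rank :: "'i \<Rightarrow> nat"
  assumes "finite A" "\<And>a. a \<in> A \<Longrightarrow> mcoeff (v a) (m a) \<noteq> 0"
    and "\<And>a b. \<lbrakk>a \<in> A; b \<in> A; a \<noteq> b; mcoeff (v a) (m b) \<noteq> 0\<rbrakk> \<Longrightarrow> rank a < rank b"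
  shows "\<exists>f \<in> mseries.span (v ` A). \<forall>a\<in>A. mcoeff f (m a) = mcoeff h (m a)"
  using assms
proof (induction "card A" arbitrary: A)
  case 0
  then show ?case by (auto intro!: bexI[of _ 0])
next
  case (Suc n)
  then have "A \<noteq> {}" by auto
  have "Max (rank ` A) \<in> rank ` A" using Suc.prems(1) \<open>A \<noteq> {}\<close> by simp
  then obtain b where b: "b \<in> A" "rank b = Max (rank ` A)" by auto
  have max: "rank a \<le> rank b" if "a \<in> A" for a using Suc.prems(1) that b(2) by simp
  have "\<exists>f \<in> mseries.span (v ` (A - {b})). \<forall>a\<in>A - {b}. mcoeff f (m a) = mcoeff h (m a)"
    by (rule Suc.hyps(1)) (use Suc b in auto)
  then obtain f where f: "f \<in> mseries.span (v ` (A - {b}))"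
    "\<And>a. a \<in> A - {b} \<Longrightarrow> mcoeff f (m a) = mcoeff h (m a)" by blast
  define c where "c = (mcoeff h (m b) - mcoeff f (m b)) / mcoeff (v b) (m b)"
  have "mcoeff (f + mscale c (v b)) (m a) = mcoeff h (m a)" if "a \<in> A" for a
  proof (cases "a = b")
    case True
    then show ?thesis using Suc.prems(2)[OF b(1)] by (simp add: c_def)
  next
    case False
    then have "mcoeff (v b) (m a) = 0" using Suc.prems(3)[of b a] b(1) max[OF that] that by fastforce
    then show ?thesis using f(2) that False by simp
  qed
  moreover have "f + mscale c (v b) \<in> mseries.span (v ` A)"
    using f(1) b(1) mseries.span_mono[of "v ` (A - {b})" "v ` A"]
    by (intro mseries.span_add mseries.span_scale) (auto intro: mseries.span_base)
  ultimately show ?case by blast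
qed

text \<open>Translation to the notion for sets.\<close>

lemma lin_indep_familyD:
  assumes "lin_indep_family v A" "finite A"
  shows "inj_on v A" "mseries.independent (v ` A)"
proof -
  show inj: "inj_on v A"
  proof (rule inj_onI, rule ccontr)
    fix a b assume ab: "a \<in> A" "b \<in> A" "v a = v b" "a \<noteq> b"
    define c :: "'a \<Rightarrow> F" where "c x = (if x = a then 1 else if x = b then -1 else 0)" for x
    have "(\<Sum>x\<in>A. mscale (c x) (v x)) = (\<Sum>x\<in>{a, b}. mscale (c x) (v x))"
      using ab assms(2) by (intro sum.mono_neutral_right) (auto simp: c_def)
    also have "\<dots> = 0" using ab by (simp add: c_def)
    finally have "c a = 0" using assms(1) ab(1) by (auto simp: lin_indep_family_def)
    then show False by (simp add: c_def)
  qed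
  have "\<forall>w\<in>v ` A. u w = 0" if "(\<Sum>w\<in>v ` A. mscale (u w) w) = 0" for u
  proof -
    have "(\<Sum>a\<in>A. mscale (u (v a)) (v a)) = 0" using that by (simp add: sum.reindex[OF inj])
    then have "\<forall>a\<in>A. u (v a) = 0"
      using assms(1) unfolding lin_indep_family_def by (elim allE[of _ "\<lambda>a. u (v a)"]) simp
    then show ?thesis by simp
  qed
  then show "mseries.independent (v ` A)"
    using mseries.dependent_finite[of "v ` A"] assms(2) by auto
qed

text \<open>Triangularity with respect to the energy, each \<open>X\<close> being tested at some monomial of shape \<open>X\<close>.\<close>

lemma psum_prod_independent:
  assumes "finite S" "\<And>X x. \<lbrakk>X \<in> S; x \<in># X\<rbrakk> \<Longrightarrow> snd x > 0"
  shows "lin_indep_family psum_prod S"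
proof -
  have "\<forall>X\<in>S. \<exists>M. shape M = X" using assms(2) shape_surj by metis
  then obtain m where m: "\<And>X. X \<in> S \<Longrightarrow> shape (m X) = X" by metis
  show ?thesis
  proof (rule triangular_independent[OF assms(1)])
    show "mcoeff (psum_prod X) (m X) \<noteq> 0" if "X \<in> S" for X
      using mcoeff_psum_prod_shape[of "m X"] m[OF that] by simp
    show "energy X < energy Y"
      if "X \<in> S" "Y \<in> S" "X \<noteq> Y" "mcoeff (psum_prod X) (m Y) \<noteq> 0" for X Y
      using psum_prod_triangular[OF that(4) assms(2)[OF that(1)]] m that(2,3)
      by (metis linorder_not_less)
  qed
qed

text \<open>The multisets that come from \<open>e\<close>-partitions.\<close>

definition index_multisets :: "nat \<Rightarrow> (nat \<times> nat) multiset set" where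
  "index_multisets e = {X. \<forall>(k, r)\<in>#X. k < e \<and> r > 0}"

definition psum_tw_prod :: "nat \<Rightarrow> complex \<Rightarrow> (nat \<times> nat) multiset \<Rightarrow> series" where
  "psum_tw_prod e \<zeta> X = (\<Prod>(k, r)\<in>#X. psum_tw e \<zeta> k r)"

lemma psum_tw_prod_add: "psum_tw_prod e \<zeta> (X + Y) = psum_tw_prod e \<zeta> X * psum_tw_prod e \<zeta> Y"
  by (simp add: psum_tw_prod_def)

lemma psum_tw_prod_empty [simp]: "psum_tw_prod e \<zeta> {#} = 1"
  by (simp add: psum_tw_prod_def)

lemma F_const_add: "F_const (a + b) = F_const a + F_const b"
  by (simp add: F_const_def)

lemma F_const_mult: "F_const (a * b) = F_const a * F_const b"
  by (simp add: F_const_def)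

lemma F_const_0: "F_const 0 = 0"
  by (simp add: F_const_def fract_collapse)

lemma F_const_1: "F_const 1 = 1"
  by (simp add: F_const_def fract_collapse flip: one_pCons)

lemma F_const_sum: "F_const (\<Sum>a\<in>A. f a) = (\<Sum>a\<in>A. F_const (f a))"
  by (induction A rule: infinite_finite_induct) (auto simp: F_const_add F_const_0)

text \<open>A geometric sum in the \<open>e\<close>-th root of unity \<open>\<zeta>\<^sup>j / \<zeta>\<^sup>k\<close>, which is 1 only if \<open>j = k\<close>.\<close>

lemma root_of_unity_sum:
  assumes "primitive_root_of_unity e \<zeta>" "j < e" "k < e"
  shows "(\<Sum>i<e. inverse \<zeta> ^ (i * k) * \<zeta> ^ (i * j)) = (if j = k then of_nat e else 0)"
proof -
  have e: "e > 0" and ze: "\<zeta> ^ e = 1"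
    and prim: "\<And>l. \<lbrakk>0 < l; l < e\<rbrakk> \<Longrightarrow> \<zeta> ^ l \<noteq> 1"
    using assms(1) by (auto simp: primitive_root_of_unity_def)
  then have z0: "\<zeta> \<noteq> 0" by (auto simp: power_0_left)
  define w where "w = \<zeta> ^ j / \<zeta> ^ k"
  have "(\<Sum>i<e. inverse \<zeta> ^ (i * k) * \<zeta> ^ (i * j)) = (\<Sum>i<e. w ^ i)"
    using z0 by (simp add: w_def power_divide power_inverse field_simps power_mult[symmetric])
  moreover have "w = 1 \<longleftrightarrow> j = k"
  proof
    assume "w = 1"
    then have eq: "\<zeta> ^ j = \<zeta> ^ k" using z0 by (simp add: w_def)
    have False if "\<zeta> ^ a = \<zeta> ^ b" "a < b" "b < e" for a b
    proof -
      have "\<zeta> ^ a * \<zeta> ^ (b - a) = \<zeta> ^ b"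
        using that(2) by (simp flip: power_add)
      then have "\<zeta> ^ (b - a) = 1" using z0 that(1) by simp
      then show False using prim[of "b - a"] that by simp
    qed
    then show "j = k" using eq assms(2,3) by (metis linorder_neqE_nat)
  qed (use z0 in \<open>simp add: w_def\<close>)
  moreover have "w ^ e = (\<zeta> ^ e) ^ j / (\<zeta> ^ e) ^ k"
    by (simp add: w_def power_divide mult.commute flip: power_mult)
  then have "(\<Sum>i<e. w ^ i) = 0" if "w \<noteq> 1"
    using that ze by (simp add: geometric_sum)
  ultimately show ?thesis by auto
qed

text \<open>Fourier inversion on the cyclic group of order \<open>e\<close>.\<close>

lemma psum_eq_twisted:
  assumes "primitive_root_of_unity e \<zeta>" "k < e" "r > 0"
  shows "psum k r = (\<Sum>i<e. mscale (F_const (inverse \<zeta> ^ (i * k) / of_nat e)) (psum_tw e \<zeta> i r))"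
proof -
  have e: "e > 0" using assms(2) by simp
  have "(\<Sum>i<e. mscale (F_const (inverse \<zeta> ^ (i * k) / of_nat e)) (psum_tw e \<zeta> i r))
      = (\<Sum>i<e. \<Sum>j<e. mscale (F_const (inverse \<zeta> ^ (i * k) * \<zeta> ^ (i * j) / of_nat e)) (psum j r))"
    using assms(3) by (simp add: psum_tw_def mseries.scale_sum_right flip: F_const_mult)
  also have "\<dots> = (\<Sum>j<e. \<Sum>i<e. mscale (F_const (inverse \<zeta> ^ (i * k) * \<zeta> ^ (i * j) / of_nat e)) (psum j r))"
    by (rule sum.swap)
  also have "\<dots> = (\<Sum>j<e. mscale (F_const (\<Sum>i<e. inverse \<zeta> ^ (i * k) * \<zeta> ^ (i * j) / of_nat e)) (psum j r))"
    by (simp add: F_const_sum mseries.scale_sum_left)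
  also have "\<dots> = (\<Sum>j<e. if j = k then psum j r else 0)"
    using e assms by (intro sum.cong)
      (auto simp: F_const_0 F_const_1 root_of_unity_sum simp flip: sum_divide_distrib)
  also have "\<dots> = psum k r" using assms(2) by simp
  finally show ?thesis by simp
qed

text \<open>Inverting the Fourier transform in each factor changes the alphabets but not the degrees. So only
  finitely many twisted products occur, namely as many as there are products of power sums with
  these degrees.\<close>

lemma psum_prod_twisted:
  assumes "primitive_root_of_unity e \<zeta>" "X \<in> index_multisets e"
  shows "psum_prod X \<in> mseries.span
    (psum_tw_prod e \<zeta> ` {Y \<in> index_multisets e. image_mset snd Y = image_mset snd X})"
  using assms(2)
proof (induction X)
  case empty
  then show ?case by (auto intro: mseries.span_base)
next
  case (add x X)
  obtain k r where x: "x = (k, r)" by (cases x)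
  have kr: "k < e" "r > 0" and X: "X \<in> index_multisets e"
    using add.prems by (auto simp: x index_multisets_def)
  let ?A = "(\<lambda>i. psum_tw e \<zeta> i r) ` {..<e}"
  have "psum k r \<in> mseries.span ?A"
    unfolding psum_eq_twisted[OF assms(1) kr]
    by (intro mseries.span_sum mseries.span_scale mseries.span_base) auto
  then have "psum k r * psum_prod X \<in> mseries.span
      (psum_tw_prod e \<zeta> ` {Y \<in> index_multisets e. image_mset snd Y = image_mset snd (add_mset x X)})"
    using add.IH[OF X]
  proof (rule span_mult)
    fix a b assume "a \<in> ?A"
      "b \<in> psum_tw_prod e \<zeta> ` {Y \<in> index_multisets e. image_mset snd Y = image_mset snd X}"
    then obtain i Y where i: "i < e" "a = psum_tw e \<zeta> i r" and
      Y: "Y \<in> index_multisets e" "image_mset snd Y = image_mset snd X" "b = psum_tw_prod e \<zeta> Y" by auto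
    have "a * b = psum_tw_prod e \<zeta> (add_mset (i, r) Y)" using i Y by (simp add: psum_tw_prod_def)
    moreover have "add_mset (i, r) Y \<in> index_multisets e"
      using i Y kr by (auto simp: index_multisets_def)
    ultimately show "a * b \<in> mseries.span (psum_tw_prod e \<zeta> `
        {Y \<in> index_multisets e. image_mset snd Y = image_mset snd (add_mset x X)})"
      using Y x by (intro mseries.span_base) auto
  qed
  then show ?case by (simp add: x)
qed

text \<open>Enlarge \<open>A\<close> to a finite set \<open>S\<close> closed under changing alphabets. If one twisted product from \<open>S\<close>
  were a combination of the others, then fewer than \<open>card S\<close> vectors would span the \<open>card S\<close>
  independent products of power sums indexed by \<open>S\<close>.\<close>

lemma psum_tw_prod_independent:
  assumes "primitive_root_of_unity e \<zeta>" "finite A" "A \<subseteq> index_multisets e"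
  shows "lin_indep_family (psum_tw_prod e \<zeta>) A"
  unfolding lin_indep_family_def
proof (intro allI impI, rule ccontr)
  fix c assume 0: "(\<Sum>X\<in>A. mscale (c X) (psum_tw_prod e \<zeta> X)) = 0" and "\<not> (\<forall>X\<in>A. c X = 0)"
  then obtain X0 where X0: "X0 \<in> A" "c X0 \<noteq> 0" by blast
  \<comment> \<open>finite, because the degrees are kept, and closed under changing the alphabets of the factors\<close>
  define S where "S = {Y \<in> index_multisets e. \<exists>X\<in>A. image_mset snd Y = image_mset snd X}"
  have AS: "A \<subseteq> S" using assms(3) by (auto simp: S_def)
  have finS: "finite S"
  proof (rule finite_subset)
    show "S \<subseteq> (\<Union>X\<in>A. multisets_of_size ({..<e} \<times> snd ` set_mset X) (size X))"
    proof
      fix Y assume "Y \<in> S"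
      then obtain X where X: "X \<in> A" "image_mset snd Y = image_mset snd X"
        and Y: "Y \<in> index_multisets e" by (auto simp: S_def)
      have "snd ` set_mset Y = snd ` set_mset X" "size Y = size X"
        using X(2) by (metis set_image_mset, metis size_image_mset)
      moreover have "set_mset Y \<subseteq> {..<e} \<times> snd ` set_mset Y"
        using Y by (force simp: index_multisets_def)
      ultimately show "Y \<in> (\<Union>X\<in>A. multisets_of_size ({..<e} \<times> snd ` set_mset X) (size X))"
        using X(1) by (auto simp: multisets_of_size_def)
    qed
  qed (use assms(2) in auto)
  let ?T = "psum_tw_prod e \<zeta>"
  have "?T X0 \<in> mseries.span (?T ` (S - {X0}))"
  proof -
    have "mscale (c X0) (?T X0) = - (\<Sum>X\<in>A - {X0}. mscale (c X) (?T X))"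
      using 0 sum.remove[OF assms(2) X0(1), of "\<lambda>X. mscale (c X) (?T X)"]
      by (simp add: eq_neg_iff_add_eq_0)
    then have "mscale (inverse (c X0)) (mscale (c X0) (?T X0)) \<in> mseries.span (?T ` (S - {X0}))"
    proof (simp only:, intro mseries.span_scale mseries.span_neg mseries.span_sum)
      fix X assume "X \<in> A - {X0}"
      then show "?T X \<in> mseries.span (?T ` (S - {X0}))" using AS by (auto intro: mseries.span_base)
    qed
    then show ?thesis using X0 by simp
  qed
  then have span: "mseries.span (?T ` (S - {X0})) = mseries.span (?T ` S)"
    using mseries.span_redundant[of "?T X0" "?T ` (S - {X0})"] X0(1) AS
    by (metis image_insert insert_Diff subsetD)
  have ind: "lin_indep_family psum_prod S"
    by (rule psum_prod_independent[OF finS]) (auto simp: S_def index_multisets_def)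
  have "psum_prod ` S \<subseteq> mseries.span (?T ` (S - {X0}))"
  proof
    fix f assume "f \<in> psum_prod ` S"
    then obtain X where X: "X \<in> S" "f = psum_prod X" by blast
    then have "f \<in> mseries.span (?T ` {Y \<in> index_multisets e. image_mset snd Y = image_mset snd X})"
      using psum_prod_twisted[OF assms(1)] by (simp add: S_def)
    moreover have "{Y \<in> index_multisets e. image_mset snd Y = image_mset snd X} \<subseteq> S"
      using X(1) by (auto simp: S_def)
    ultimately show "f \<in> mseries.span (?T ` (S - {X0}))"
      unfolding span using mseries.span_mono[OF image_mono, of _ S ?T] by blast
  qed
  from mseries.independent_span_bound[OF _ lin_indep_familyD(2)[OF ind finS] this]
  have "card (psum_prod ` S) \<le> card (?T ` (S - {X0}))" using finS by simp
  also have "\<dots> \<le> card (S - {X0})" using finS by (intro card_image_le) simp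
  also have "\<dots> < card S" using finS X0 AS by (intro card_Diff1_less) auto
  also have "\<dots> = card (psum_prod ` S)"
    by (rule card_image[OF lin_indep_familyD(1)[OF ind finS], symmetric])
  finally show False by simp
qed

text \<open>For a weakly decreasing sequence, \<open>l j > x\<close> holds if and only if more than \<open>j\<close> of the parts
  exceed \<open>x\<close>, and this depends on the multiset of parts only.\<close>

lemma antimono_determined_by_parts:
  fixes l l' :: "nat \<Rightarrow> nat"
  assumes "antimono l" "antimono l'" "finite {j. l j \<noteq> 0}" "finite {j. l' j \<noteq> 0}"
    and eq: "image_mset l (mset_set {j. l j \<noteq> 0}) = image_mset l' (mset_set {j. l' j \<noteq> 0})"
  shows "l = l'"
proof -
  have *: "l j > x \<longleftrightarrow> j < size (filter_mset (\<lambda>y. y > x) (image_mset l (mset_set {j. l j \<noteq> 0})))"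
    if l: "antimono l" and fin: "finite {j. l j \<noteq> 0}" for l :: "nat \<Rightarrow> nat" and x j
  proof -
    have "filter_mset (\<lambda>y. y > x) (image_mset l (mset_set {j. l j \<noteq> 0}))
        = image_mset l (mset_set {j. l j > x})"
    proof -
      have "{j \<in> {j. l j \<noteq> 0}. l j > x} = {j. l j > x}" by auto
      then show ?thesis using fin by (simp only: filter_mset_image_mset filter_mset_mset_set)
    qed
    then have size: "size (filter_mset (\<lambda>y. y > x) (image_mset l (mset_set {j. l j \<noteq> 0})))
        = card {j. l j > x}" by simp
    have fx: "finite {j. l j > x}" by (rule finite_subset[OF _ fin]) auto
    have down: "i \<in> {j. l j > x}" if "i \<le> i'" "i' \<in> {j. l j > x}" for i i'
      using antimonoD[OF l that(1)] that(2) by simp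
    show ?thesis unfolding size
    proof
      assume "l j > x"
      then have "{..j} \<subseteq> {j. l j > x}" using down by auto
      from card_mono[OF fx this] show "j < card {j. l j > x}" by simp
    next
      assume j: "j < card {j. l j > x}"
      show "l j > x"
      proof (rule ccontr)
        assume "\<not> l j > x"
        have "i < j" if "l i > x" for i
          using down[of j i] that \<open>\<not> l j > x\<close> by (cases "i < j") auto
        then have "{j. l j > x} \<subseteq> {..<j}" by auto
        from card_mono[OF _ this] j show False by simp
      qed
    qed
  qed
  have gt: "l j > x \<longleftrightarrow> l' j > x" for j x
    by (rule trans[OF *[OF assms(1,3), unfolded eq] *[OF assms(2,4), symmetric]])
  show ?thesis
  proof
    fix j
    show "l j = l' j" using gt[of "l j" j] gt[of "l' j" j] by linarith
  qed
qed

text \<open>Encodes an \<open>e\<close>-partition as the multiset of its nonzero parts, each tagged with its component.\<close>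

definition parts :: "nat \<Rightarrow> epart \<Rightarrow> (nat \<times> nat) multiset" where
  "parts e \<alpha> = (\<Sum>k<e. image_mset (\<lambda>j. (k, \<alpha> k j)) (mset_set {j. \<alpha> k j \<noteq> 0}))"

lemma psum_ep_eq: "psum_ep e \<zeta> \<alpha> = psum_tw_prod e \<zeta> (parts e \<alpha>)"
proof -
  have *: "psum_tw_prod e \<zeta> (\<Sum>k\<in>K. f k) = (\<Prod>k\<in>K. psum_tw_prod e \<zeta> (f k))" for f K
    by (induction K rule: infinite_finite_induct) (auto simp: psum_tw_prod_add)
  show ?thesis unfolding parts_def * psum_ep_def
    by (intro prod.cong refl)
      (simp add: psum_tw_prod_def image_mset.compositionality comp_def prod_unfold_prod_mset)
qed

text \<open>Each component is recovered from the tagged multiset.\<close>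

lemma filter_parts:
  assumes "k < e"
  shows "filter_mset (\<lambda>x. fst x = k) (parts e \<alpha>)
    = image_mset (\<lambda>j. (k, \<alpha> k j)) (mset_set {j. \<alpha> k j \<noteq> 0})"
proof -
  have *: "filter_mset P (\<Sum>k\<in>K. f k) = (\<Sum>k\<in>K. filter_mset P (f k))"
    for P and f :: "nat \<Rightarrow> (nat \<times> nat) multiset" and K
    by (induction K rule: infinite_finite_induct) auto
  have "filter_mset (\<lambda>x. fst x = k) (image_mset (\<lambda>j. (k', \<alpha> k' j)) (mset_set {j. \<alpha> k' j \<noteq> 0}))
     = (if k' = k then image_mset (\<lambda>j. (k', \<alpha> k' j)) (mset_set {j. \<alpha> k' j \<noteq> 0}) else {#})" for k'
    by (auto simp: filter_mset_image_mset)
  then show ?thesis using assms unfolding parts_def * by (simp add: sum.delta)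
qed

lemma parts_inj: "inj_on (parts e) (epartitions e)"
proof (rule inj_onI, rule ext)
  fix \<alpha> \<beta> k assume ab: "\<alpha> \<in> epartitions e" "\<beta> \<in> epartitions e" "parts e \<alpha> = parts e \<beta>"
  show "\<alpha> k = \<beta> k"
  proof (cases "k < e")
    case True
    have "image_mset snd (filter_mset (\<lambda>x. fst x = k) (parts e \<alpha>))
        = image_mset snd (filter_mset (\<lambda>x. fst x = k) (parts e \<beta>))" using ab by simp
    then have "image_mset (\<alpha> k) (mset_set {j. \<alpha> k j \<noteq> 0}) = image_mset (\<beta> k) (mset_set {j. \<beta> k j \<noteq> 0})"
      unfolding filter_parts[OF True] by (simp add: image_mset.compositionality comp_def)
    moreover have "partition (\<alpha> k)" "partition (\<beta> k)" using ab True by (auto simp: epartitions_def)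
    ultimately show ?thesis unfolding partition_def by (intro antimono_determined_by_parts) auto
  next
    case False
    then show ?thesis using ab by (auto simp: epartitions_def)
  qed
qed

lemma partition_of_multiset:
  assumes "0 \<notin># R"
  obtains l where "partition l" "image_mset l (mset_set {j. l j \<noteq> 0}) = R"
proof -
  define xs where "xs = rev (sorted_list_of_multiset R)"
  define l where "l j = (if j < length xs then xs ! j else 0)" for j
  have mset: "mset xs = R" by (simp add: xs_def)
  have supp: "{j. l j \<noteq> 0} = {..<length xs}"
    using assms unfolding mset[symmetric] by (auto simp: l_def) (metis gr0I nth_mem)
  have "sorted_wrt (\<ge>) xs" by (simp add: xs_def sorted_wrt_rev)
  then have "antimono l"
    unfolding sorted_wrt_iff_nth_less by (intro antimonoI) (auto simp: l_def le_less)
  moreover have "image_mset l (mset_set {j. l j \<noteq> 0}) = image_mset ((!) xs) (mset [0..<length xs])"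
    unfolding supp mset_upt lessThan_atLeast0 by (intro image_mset_cong) (simp add: l_def)
  then have "image_mset l (mset_set {j. l j \<noteq> 0}) = R"
    unfolding mset_map[symmetric] map_nth mset .
  moreover have "finite {j. l j \<noteq> 0}" unfolding supp by simp
  ultimately show ?thesis by (intro that) (simp_all add: partition_def)
qed

lemma parts_image: "parts e ` epartitions e = index_multisets e"
proof
  show "parts e ` epartitions e \<subseteq> index_multisets e"
  proof
    fix X assume "X \<in> parts e ` epartitions e"
    then obtain \<alpha> where \<alpha>: "X = parts e \<alpha>" by auto
    have "set_mset X \<subseteq> (\<Union>k<e. {k} \<times> {0<..})"
    proof -
      have "set_mset (\<Sum>k\<in>K. f k) \<subseteq> (\<Union>k\<in>K. set_mset (f k))"
        for f :: "nat \<Rightarrow> (nat \<times> nat) multiset" and K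
        by (induction K rule: infinite_finite_induct) auto
      moreover have "set_mset (image_mset (\<lambda>j. (k, \<alpha> k j)) (mset_set {j. \<alpha> k j \<noteq> 0})) \<subseteq> {k} \<times> {0<..}" for k
        by (cases "finite {j. \<alpha> k j \<noteq> 0}") auto
      ultimately show ?thesis unfolding \<alpha> parts_def by (meson SUP_mono' order_trans)
    qed
    then show "X \<in> index_multisets e" by (auto simp: index_multisets_def)
  qed
next
  show "index_multisets e \<subseteq> parts e ` epartitions e"
  proof
    fix X assume X: "X \<in> index_multisets e"
    define R where "R k = image_mset snd (filter_mset (\<lambda>x. fst x = k) X)" for k
    have "\<exists>l. partition l \<and> image_mset l (mset_set {j. l j \<noteq> 0}) = R k" for k
      by (rule partition_of_multiset[of "R k"]) (use X in \<open>auto simp: R_def index_multisets_def\<close>)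
    then obtain l where l: "\<And>k. partition (l k)" "\<And>k. image_mset (l k) (mset_set {j. l k j \<noteq> 0}) = R k"
      by metis
    define \<alpha> where "\<alpha> k = (if k < e then l k else (\<lambda>_. 0))" for k
    have "parts e \<alpha> = (\<Sum>k<e. filter_mset (\<lambda>x. fst x = k) X)"
      unfolding parts_def
    proof (intro sum.cong refl)
      fix k assume "k \<in> {..<e}"
      then have "image_mset (\<lambda>j. (k, \<alpha> k j)) (mset_set {j. \<alpha> k j \<noteq> 0}) = image_mset (Pair k) (R k)"
        unfolding l(2)[symmetric] by (simp add: \<alpha>_def image_mset.compositionality comp_def)
      also have "\<dots> = image_mset (\<lambda>x. x) (filter_mset (\<lambda>x. fst x = k) X)"
        unfolding R_def image_mset.compositionality comp_def by (intro image_mset_cong) auto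
      finally show "image_mset (\<lambda>j. (k, \<alpha> k j)) (mset_set {j. \<alpha> k j \<noteq> 0})
        = filter_mset (\<lambda>x. fst x = k) X" by simp
    qed
    also have "\<dots> = X"
    proof (rule multiset_eqI)
      fix x
      have "count (\<Sum>k<e. filter_mset (\<lambda>x. fst x = k) X) x = (\<Sum>k<e. if fst x = k then count X x else 0)"
        by (simp add: count_sum)
      also have "\<dots> = (if fst x < e then count X x else 0)" by simp
      also have "\<dots> = count X x" using X by (auto simp: index_multisets_def count_eq_zero_iff)
      finally show "count (\<Sum>k<e. filter_mset (\<lambda>x. fst x = k) X) x = count X x" .
    qed
    finally have "parts e \<alpha> = X" .
    moreover have "\<alpha> \<in> epartitions e" using l(1) by (auto simp: epartitions_def \<alpha>_def)
    ultimately show "X \<in> parts e ` epartitions e" by blast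
  qed
qed

section \<open>Anisotropy of the sesquilinear form\<close>

text \<open>Transfers independence from multisets to \<open>e\<close>-partitions.\<close>

lemma lin_indep_family_reindex:
  assumes "lin_indep_family v (h ` A)" "inj_on h A"
  shows "lin_indep_family (\<lambda>a. v (h a)) A"
  unfolding lin_indep_family_def
proof (intro allI impI)
  fix c assume "(\<Sum>a\<in>A. mscale (c a) (v (h a))) = 0"
  then have "(\<Sum>b\<in>h ` A. mscale (c (the_inv_into A h b)) (v b)) = 0"
    using assms(2) by (simp add: sum.reindex the_inv_into_f_f cong: sum.cong)
  then have "\<forall>b\<in>h ` A. c (the_inv_into A h b) = 0"
    using assms(1) unfolding lin_indep_family_def by (elim allE[of _ "\<lambda>b. c (the_inv_into A h b)"]) simp
  then show "\<forall>a\<in>A. c a = 0" using assms(2) by (simp add: the_inv_into_f_f)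
qed

definition psum_span :: "nat \<Rightarrow> complex \<Rightarrow> series set" where
  "psum_span e \<zeta> = mseries.span (psum_ep e \<zeta> ` epartitions e)"

lemma psum_span_eq: "psum_span e \<zeta> = mseries.span (psum_tw_prod e \<zeta> ` index_multisets e)"
  by (simp add: psum_span_def psum_ep_eq image_image flip: parts_image)

lemma psum_prod_psum_span:
  assumes "primitive_root_of_unity e \<zeta>" "X \<in> index_multisets e"
  shows "psum_prod X \<in> psum_span e \<zeta>"
  using psum_prod_twisted[OF assms]
    mseries.span_mono[of "psum_tw_prod e \<zeta> ` {Y \<in> index_multisets e. image_mset snd Y = image_mset snd X}"
      "psum_tw_prod e \<zeta> ` index_multisets e"]
  unfolding psum_span_eq by blast

lemma psum_span_mult:
  assumes "f \<in> psum_span e \<zeta>" "g \<in> psum_span e \<zeta>"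
  shows "f * g \<in> psum_span e \<zeta>"
  using assms unfolding psum_span_eq
proof (rule span_mult)
  fix a b assume "a \<in> psum_tw_prod e \<zeta> ` index_multisets e" "b \<in> psum_tw_prod e \<zeta> ` index_multisets e"
  then obtain X Y where XY: "X \<in> index_multisets e" "Y \<in> index_multisets e"
    "a * b = psum_tw_prod e \<zeta> (X + Y)" by (auto simp: psum_tw_prod_add)
  then have "X + Y \<in> index_multisets e" by (auto simp: index_multisets_def)
  then show "a * b \<in> mseries.span (psum_tw_prod e \<zeta> ` index_multisets e)"
    using XY by (auto intro: mseries.span_base)
qed

lemma psum_span_prod:
  assumes "\<And>k. k \<in> K \<Longrightarrow> f k \<in> psum_span e \<zeta>"
  shows "prod f K \<in> psum_span e \<zeta>"
proof -
  have "1 \<in> psum_span e \<zeta>"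
    unfolding psum_span_eq
    by (rule mseries.span_base) (auto simp: index_multisets_def intro!: image_eqI[of _ _ "{#}"])
  then show ?thesis using assms
    by (induction K rule: infinite_finite_induct) (auto intro: psum_span_mult)
qed

text \<open>The condition that characterises the coordinates of \<open>f\<close>, as a relation, which unlike the chosen
  coordinates can be handled before uniqueness is known.\<close>

definition represents :: "nat \<Rightarrow> complex \<Rightarrow> series \<Rightarrow> (epart \<Rightarrow> F) \<Rightarrow> bool" where
  "represents e \<zeta> f c \<longleftrightarrow> finite {\<alpha>. c \<alpha> \<noteq> 0} \<and> {\<alpha>. c \<alpha> \<noteq> 0} \<subseteq> epartitions e \<and>
     f = (\<Sum>\<alpha> | c \<alpha> \<noteq> 0. mscale (c \<alpha>) (psum_ep e \<zeta> \<alpha>))"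

lemma representsI:
  assumes "finite A" "A \<subseteq> epartitions e" "{\<alpha>. c \<alpha> \<noteq> 0} \<subseteq> A"
    and "f = (\<Sum>\<alpha>\<in>A. mscale (c \<alpha>) (psum_ep e \<zeta> \<alpha>))"
  shows "represents e \<zeta> f c"
proof -
  have "f = (\<Sum>\<alpha> | c \<alpha> \<noteq> 0. mscale (c \<alpha>) (psum_ep e \<zeta> \<alpha>))"
    unfolding assms(4) by (rule sum.mono_neutral_right) (use assms in auto)
  then show ?thesis
    using assms finite_subset[OF assms(3,1)] unfolding represents_def by blast
qed

lemma representsD:
  assumes "represents e \<zeta> f c" "finite A" "{\<alpha>. c \<alpha> \<noteq> 0} \<subseteq> A"
  shows "f = (\<Sum>\<alpha>\<in>A. mscale (c \<alpha>) (psum_ep e \<zeta> \<alpha>))"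
proof -
  have "(\<Sum>\<alpha> | c \<alpha> \<noteq> 0. mscale (c \<alpha>) (psum_ep e \<zeta> \<alpha>)) = (\<Sum>\<alpha>\<in>A. mscale (c \<alpha>) (psum_ep e \<zeta> \<alpha>))"
    by (rule sum.mono_neutral_left) (use assms in auto)
  then show ?thesis using assms(1) unfolding represents_def by simp
qed

lemma represents_supp:
  assumes "represents e \<zeta> f c" "represents e \<zeta> g d"
  obtains A where "finite A" "A \<subseteq> epartitions e" "{\<alpha>. c \<alpha> \<noteq> 0} \<subseteq> A" "{\<alpha>. d \<alpha> \<noteq> 0} \<subseteq> A"
  using assms that[of "{\<alpha>. c \<alpha> \<noteq> 0} \<union> {\<alpha>. d \<alpha> \<noteq> 0}"] unfolding represents_def by blast

lemma represents_add:
  assumes "represents e \<zeta> f c" "represents e \<zeta> g d"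
  shows "represents e \<zeta> (f + g) (\<lambda>\<alpha>. c \<alpha> + d \<alpha>)"
proof -
  obtain A where A: "finite A" "A \<subseteq> epartitions e" "{\<alpha>. c \<alpha> \<noteq> 0} \<subseteq> A" "{\<alpha>. d \<alpha> \<noteq> 0} \<subseteq> A"
    by (rule represents_supp[OF assms])
  show ?thesis
  proof (rule representsI[OF A(1,2)])
    show "{\<alpha>. c \<alpha> + d \<alpha> \<noteq> 0} \<subseteq> A" using A(3,4) by force
    show "f + g = (\<Sum>\<alpha>\<in>A. mscale (c \<alpha> + d \<alpha>) (psum_ep e \<zeta> \<alpha>))"
      using representsD[OF assms(1) A(1,3)] representsD[OF assms(2) A(1,4)]
      by (simp add: mseries.scale_left_distrib sum.distrib)
  qed
qed

lemma represents_scale: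
  assumes "represents e \<zeta> f c"
  shows "represents e \<zeta> (mscale a f) (\<lambda>\<alpha>. a * c \<alpha>)"
proof (rule representsI)
  show "finite {\<alpha>. c \<alpha> \<noteq> 0}" "{\<alpha>. c \<alpha> \<noteq> 0} \<subseteq> epartitions e"
    using assms by (auto simp: represents_def)
  then show "mscale a f = (\<Sum>\<alpha> | c \<alpha> \<noteq> 0. mscale (a * c \<alpha>) (psum_ep e \<zeta> \<alpha>))"
    using assms by (simp add: represents_def mseries.scale_sum_right)
qed auto

lemma represents_ex:
  assumes "f \<in> psum_span e \<zeta>"
  shows "\<exists>c. represents e \<zeta> f c"
  using assms unfolding psum_span_def
proof (induction rule: mseries.span_induct_alt)
  case base
  have "represents e \<zeta> 0 (\<lambda>_. 0)" by (rule representsI[of "{}"]) auto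
  then show ?case by blast
next
  case (step a x y)
  then obtain \<alpha> c where x: "\<alpha> \<in> epartitions e" "x = psum_ep e \<zeta> \<alpha>" and c: "represents e \<zeta> y c"
    by auto
  have "represents e \<zeta> x (\<lambda>\<beta>. if \<beta> = \<alpha> then 1 else 0)"
    by (rule representsI[of "{\<alpha>}"]) (use x in auto)
  then show ?case using represents_add[OF represents_scale c] by blast
qed

lemma psum_ep_independent:
  assumes "primitive_root_of_unity e \<zeta>" "finite A" "A \<subseteq> epartitions e"
  shows "lin_indep_family (psum_ep e \<zeta>) A"
proof -
  have "lin_indep_family (psum_tw_prod e \<zeta>) (parts e ` A)"
    using assms parts_image by (intro psum_tw_prod_independent) auto
  from lin_indep_family_reindex[OF this inj_on_subset[OF parts_inj assms(3)]]
  show ?thesis unfolding psum_ep_eq .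
qed

lemma psum_coords_eq:
  assumes "primitive_root_of_unity e \<zeta>" "represents e \<zeta> f c"
  shows "psum_coords e \<zeta> f = c"
proof -
  have "d = c" if d: "represents e \<zeta> f d" for d
  proof -
    obtain A where A: "finite A" "A \<subseteq> epartitions e" "{\<alpha>. c \<alpha> \<noteq> 0} \<subseteq> A" "{\<alpha>. d \<alpha> \<noteq> 0} \<subseteq> A"
      by (rule represents_supp[OF assms(2) d])
    have "(\<Sum>\<alpha>\<in>A. mscale (d \<alpha> - c \<alpha>) (psum_ep e \<zeta> \<alpha>)) = 0"
      using representsD[OF assms(2) A(1,3)] representsD[OF d A(1,4)]
      by (simp add: mseries.scale_left_diff_distrib sum_subtractf)
    then have "\<forall>\<alpha>\<in>A. d \<alpha> - c \<alpha> = 0"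
      using psum_ep_independent[OF assms(1) A(1,2)] unfolding lin_indep_family_def
      by (elim allE[of _ "\<lambda>\<alpha>. d \<alpha> - c \<alpha>"]) simp
    then have "\<forall>\<alpha>\<in>A. d \<alpha> = c \<alpha>" by simp
    moreover have "\<forall>\<alpha>. \<alpha> \<notin> A \<longrightarrow> d \<alpha> = c \<alpha>" using A(3,4) by force
    ultimately show "d = c" by blast
  qed
  then show ?thesis
    unfolding psum_coords_def represents_def[symmetric] by (intro the_equality assms(2))
qed

lemma Xi_form_eq:
  assumes "primitive_root_of_unity e \<zeta>" "represents e \<zeta> f c" "represents e \<zeta> g d"
    and "finite A" "{\<alpha>. c \<alpha> \<noteq> 0} \<subseteq> A"
  shows "Xi_form e \<zeta> f g = (\<Sum>\<alpha>\<in>A. c \<alpha> * F_cnj (d \<alpha>) * z_qt e \<zeta> \<alpha>)"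
  unfolding Xi_form_def psum_coords_eq[OF assms(1,2)] psum_coords_eq[OF assms(1,3)]
  using assms(4,5) by (intro sum.mono_neutral_left) auto

text \<open>In coordinates, \<open>\<langle>x, x\<rangle>\<close> is a sum of the positive elements \<open>c\<^sub>\<alpha> \<cdot> cnj c\<^sub>\<alpha> \<cdot> z\<^sub>\<alpha>(q,t)\<close> over the support
  of \<open>x\<close>, hence nonzero unless the support is empty.\<close>

theorem anisotropic_Xi_form:
  assumes "primitive_root_of_unity e \<zeta>"
  shows "anisotropic_form mscale (psum_span e \<zeta>) (Xi_form e \<zeta>) F_cnj"
proof unfold_locales
  let ?W = "psum_span e \<zeta>"
  note eq = Xi_form_eq[OF assms]
  show "mseries.subspace ?W" by (simp add: psum_span_def mseries.subspace_span)
  fix x y assume x: "x \<in> ?W" and y: "y \<in> ?W"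
  obtain c where c: "represents e \<zeta> x c" using represents_ex[OF x] by blast
  obtain d where d: "represents e \<zeta> y d" using represents_ex[OF y] by blast
  obtain A where A: "finite A" "{\<alpha>. c \<alpha> \<noteq> 0} \<subseteq> A" "{\<alpha>. d \<alpha> \<noteq> 0} \<subseteq> A"
    using represents_supp[OF c d] by metis
  show "Xi_form e \<zeta> (mscale a x) y = a * Xi_form e \<zeta> x y" for a
  proof -
    have "{\<alpha>. a * c \<alpha> \<noteq> 0} \<subseteq> A" using A by auto
    then show ?thesis
      using eq[OF represents_scale[OF c] d A(1)] eq[OF c d A(1,2)]
      by (simp add: sum_distrib_left mult.assoc)
  qed
  show "Xi_form e \<zeta> x (mscale a y) = F_cnj a * Xi_form e \<zeta> x y" for a
    using eq[OF c represents_scale[OF d] A(1,2)] eq[OF c d A(1,2)]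
    by (simp add: sum_distrib_left F_cnj_mult mult_ac)
  show "x = 0" if "Xi_form e \<zeta> x x = 0"
  proof (rule ccontr)
    assume "x \<noteq> 0"
    have ne: "{\<alpha>. c \<alpha> \<noteq> 0} \<noteq> {}"
    proof
      assume "{\<alpha>. c \<alpha> \<noteq> 0} = {}"
      then have "x = 0" using representsD[OF c, of "{}"] by simp
      then show False using \<open>x \<noteq> 0\<close> by simp
    qed
    have fin: "finite {\<alpha>. c \<alpha> \<noteq> 0}" using c by (simp add: represents_def)
    have "F_pos (c \<alpha> * F_cnj (c \<alpha>) * z_qt e \<zeta> \<alpha>)" if "c \<alpha> \<noteq> 0" for \<alpha>
      using that assms by (intro F_pos_mult[OF F_pos_mult_cnj F_pos_z_qt])
    then have "F_pos (\<Sum>\<alpha> | c \<alpha> \<noteq> 0. c \<alpha> * F_cnj (c \<alpha>) * z_qt e \<zeta> \<alpha>)"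
      using fin ne by (intro F_pos_sum) auto
    then have "F_pos (Xi_form e \<zeta> x x)" using eq[OF c c fin] by simp
    then show False using that F_pos_not_0 by simp
  qed
  fix z assume z: "z \<in> ?W"
  obtain h where h: "represents e \<zeta> z h" using represents_ex[OF z] by blast
  have A': "{\<alpha>. c \<alpha> + d \<alpha> \<noteq> 0} \<subseteq> A" using A by force
  show "Xi_form e \<zeta> (x + y) z = Xi_form e \<zeta> x z + Xi_form e \<zeta> y z"
    using eq[OF represents_add[OF c d] h A(1) A'] eq[OF c h A(1,2)] eq[OF d h A(1,3)]
    by (simp add: distrib_right sum.distrib)
  show "Xi_form e \<zeta> x (y + z) = Xi_form e \<zeta> x y + Xi_form e \<zeta> x z"
    using eq[OF c represents_add[OF d h] A(1,2)] eq[OF c d A(1,2)] eq[OF c h A(1,2)]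
    by (simp add: distrib_right distrib_left F_cnj_add sum.distrib)
qed (simp_all add: F_cnj_add F_cnj_mult F_cnj_F_cnj)

section \<open>The Bender--Knuth involution\<close>

text \<open>The numbers of entries below \<open>x\<close> in the rows form the shape of a subtableau. These shapes, for all
  \<open>x\<close>, are the rows of the Gelfand--Tsetlin pattern of \<open>T\<close>, and the Bender--Knuth involution is
  described in terms of them.\<close>

definition row_less :: "(nat \<Rightarrow> nat) \<Rightarrow> (nat \<times> nat \<Rightarrow> nat) \<Rightarrow> nat \<Rightarrow> nat \<Rightarrow> nat" where
  "row_less l T x r = card {j. j < l r \<and> T (r, j) < x}"

lemma row_less_eqI:
  assumes "\<And>j. j < l r \<Longrightarrow> T (r, j) < x \<longleftrightarrow> j < n" "n \<le> l r"
  shows "row_less l T x r = n"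
proof -
  have "{j. j < l r \<and> T (r, j) < x} = {..<n}" using assms by auto
  then show ?thesis by (simp add: row_less_def)
qed

lemma row_less_le: "row_less l T x r \<le> l r"
  using card_mono[of "{..<l r}" "{j. j < l r \<and> T (r, j) < x}"] by (auto simp: row_less_def)

lemma row_less_mono: "x \<le> y \<Longrightarrow> row_less l T x r \<le> row_less l T y r"
  unfolding row_less_def by (rule card_mono) auto

lemma ssyt_row_mono:
  assumes "T \<in> ssyt l" "i \<le> j" "j < l r"
  shows "T (r, i) \<le> T (r, j)"
  using assms(2,3)
proof (induction j rule: dec_induct)
  case (step j)
  then have "T (r, j) \<le> T (r, Suc j)" using assms(1) by (simp add: ssyt_def cells_def)
  then show ?case using step by simp
qed simp

lemma entry_less_iff:
  assumes "T \<in> ssyt l" "j < l r"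
  shows "T (r, j) < x \<longleftrightarrow> j < row_less l T x r"
proof
  let ?S = "{j. j < l r \<and> T (r, j) < x}"
  have fin: "finite ?S" by simp
  {
    assume "T (r, j) < x"
    then have "{..j} \<subseteq> ?S" using ssyt_row_mono[OF assms(1) _ assms(2)] assms(2)
      by (auto intro: le_less_trans)
    from card_mono[OF fin this] show "j < row_less l T x r" by (simp add: row_less_def)
  next
    assume j: "j < row_less l T x r"
    show "T (r, j) < x"
    proof (rule ccontr)
      assume n: "\<not> T (r, j) < x"
      have "i < j" if "i < l r" "T (r, i) < x" for i
        using ssyt_row_mono[OF assms(1) _ that(1), of j] that n by (cases "i < j") auto
      then have "?S \<subseteq> {..<j}" by auto
      from card_mono[OF _ this] j show False by (simp add: row_less_def)
    qed
  }
qed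

lemma partition_Suc_le: "partition l \<Longrightarrow> l (Suc r) \<le> l r"
  by (simp add: partition_def antimono_def)

text \<open>Strictness down the columns means that passing from the entries below \<open>x\<close> to those up to \<open>x\<close> adds a
  horizontal strip.\<close>

lemma row_less_interlace:
  assumes "partition l" "T \<in> ssyt l"
  shows "row_less l T (Suc x) (Suc r) \<le> row_less l T x r"
proof (rule ccontr)
  define j where "j = row_less l T x r"
  assume "\<not> row_less l T (Suc x) (Suc r) \<le> row_less l T x r"
  then have j: "j < row_less l T (Suc x) (Suc r)" by (simp add: j_def)
  then have jl: "j < l (Suc r)" "j < l r"
    using row_less_le[of l T "Suc x" "Suc r"] partition_Suc_le[OF assms(1), of r] by auto
  have "T (Suc r, j) < Suc x" using entry_less_iff[OF assms(2) jl(1)] j by simp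
  moreover have "T (r, j) < T (Suc r, j)" using assms(2) jl by (simp add: ssyt_def cells_def)
  ultimately have "T (r, j) < x" by simp
  then show False using entry_less_iff[OF assms(2) jl(2)] by (simp add: j_def)
qed

text \<open>Conversely, an interlacing pattern defines a semistandard tableau.\<close>

lemma ssytI_thresholds:
  assumes "partition l" "T \<in> extensional (cells l)"
    and g: "\<And>r j x. j < l r \<Longrightarrow> T (r, j) < x \<longleftrightarrow> j < g x r"
    and interlace: "\<And>x r. g (Suc x) (Suc r) \<le> g x r"
  shows "T \<in> ssyt l"
  unfolding ssyt_def
proof (intro CollectI conjI allI impI assms(2))
  fix r j assume "(r, Suc j) \<in> cells l"
  then have "j < l r" "Suc j < l r" by (auto simp: cells_def)
  then show "T (r, j) \<le> T (r, Suc j)"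
    using g[of j r "Suc (T (r, Suc j))"] g[of "Suc j" r "Suc (T (r, Suc j))"] by simp
next
  fix r j assume "(Suc r, j) \<in> cells l"
  then have j: "j < l (Suc r)" "j < l r"
    using partition_Suc_le[OF assms(1), of r] by (auto simp: cells_def)
  have "j < g (Suc (T (Suc r, j))) (Suc r)" using g[OF j(1), of "Suc (T (Suc r, j))"] by simp
  then have "j < g (T (Suc r, j)) r" using interlace[of "T (Suc r, j)" r] by simp
  then show "T (r, j) < T (Suc r, j)" using g[OF j(2)] by simp
qed

text \<open>Let \<open>a\<close> and \<open>c\<close> be two shapes of a Gelfand--Tsetlin pattern that are two steps apart. The \<open>r\<close>-th
  part of a shape in between is constrained only by the interval from \<open>lower_end a c r\<close> to
  \<open>upper_end a c r\<close>.\<close>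

definition upper_end :: "(nat \<Rightarrow> nat) \<Rightarrow> (nat \<Rightarrow> nat) \<Rightarrow> nat \<Rightarrow> nat" where
  "upper_end a c r = (case r of 0 \<Rightarrow> c 0 | Suc r' \<Rightarrow> min (a r') (c r))"

definition lower_end :: "(nat \<Rightarrow> nat) \<Rightarrow> (nat \<Rightarrow> nat) \<Rightarrow> nat \<Rightarrow> nat" where
  "lower_end a c r = max (a r) (c (Suc r))"

text \<open>The minimum in the upper end for row \<open>r + 1\<close> and the maximum in the lower end for row \<open>r\<close> have
  the same arguments, so together they contribute the sum of these. In particular, reflecting every
  part in its interval replaces the size \<open>|b|\<close> of the middle shape by \<open>|a| + |c| - |b|\<close>.\<close>

lemma sum_upper_lower_end: "(\<Sum>r<L. upper_end a c r + lower_end a c r) + upper_end a c L = (\<Sum>r<L. a r + c r) + c L"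
  by (induction L) (auto simp: upper_end_def lower_end_def)

text \<open>The part of the middle shape, reflected in the interval available to it.\<close>

definition reflected :: "(nat \<Rightarrow> nat) \<Rightarrow> nat \<Rightarrow> (nat \<times> nat \<Rightarrow> nat) \<Rightarrow> nat \<Rightarrow> nat" where
  "reflected l i T r = upper_end (row_less l T i) (row_less l T (i + 2)) r + lower_end (row_less l T i) (row_less l T (i + 2)) r
     - row_less l T (i + 1) r"

text \<open>In each row the entries \<open>i\<close> and \<open>i + 1\<close> are redistributed, with the reflected part as the new number
  of entries up to \<open>i\<close>.\<close>

definition bender_knuth :: "(nat \<Rightarrow> nat) \<Rightarrow> nat \<Rightarrow> (nat \<times> nat \<Rightarrow> nat) \<Rightarrow> nat \<times> nat \<Rightarrow> nat" where
  "bender_knuth l i T = (\<lambda>(r, j)\<in>cells l. if T (r, j) \<in> {i, i + 1}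
     then (if j < reflected l i T r then i else i + 1) else T (r, j))"

lemma row_less_between:
  assumes "partition l" "T \<in> ssyt l"
  shows "lower_end (row_less l T i) (row_less l T (i + 2)) r \<le> row_less l T (i + 1) r"
    and "row_less l T (i + 1) r \<le> upper_end (row_less l T i) (row_less l T (i + 2)) r"
  using row_less_interlace[OF assms, of "i + 1" r] row_less_interlace[OF assms, of i]
    row_less_mono[of i "i + 1" l T r] row_less_mono[of "i + 1" "i + 2" l T r]
  by (auto simp: upper_end_def lower_end_def split: nat.split)

lemma reflected_between:
  assumes "partition l" "T \<in> ssyt l"
  shows "lower_end (row_less l T i) (row_less l T (i + 2)) r \<le> reflected l i T r"
    and "reflected l i T r \<le> upper_end (row_less l T i) (row_less l T (i + 2)) r"
  using row_less_between[OF assms, of i r] unfolding reflected_def by auto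

lemma reflected_bounds:
  assumes "partition l" "T \<in> ssyt l"
  shows "row_less l T i r \<le> reflected l i T r" "reflected l i T r \<le> row_less l T (i + 2) r"
    and "reflected l i T (Suc r) \<le> row_less l T i r" "row_less l T (i + 2) (Suc r) \<le> reflected l i T r"
  using reflected_between[OF assms, of i r] reflected_between[OF assms, of i "Suc r"]
  by (auto simp: upper_end_def lower_end_def split: nat.splits)

lemma bender_knuth_less_iff:
  assumes "partition l" "T \<in> ssyt l" "j < l r"
  shows "bender_knuth l i T (r, j) < x \<longleftrightarrow> j < (if x = i + 1 then reflected l i T r else row_less l T x r)"
proof -
  have cell: "(r, j) \<in> cells l" using assms(3) by (simp add: cells_def)
  note row_less = entry_less_iff[OF assms(2,3)]
  show ?thesis
  proof (cases "x = i + 1")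
    case True
    have "T (r, j) < i \<longleftrightarrow> j < row_less l T i r" "T (r, j) < i + 2 \<longleftrightarrow> j < row_less l T (i + 2) r"
      by (rule row_less)+
    then show ?thesis
      using True cell reflected_bounds(1,2)[OF assms(1,2), of i r] by (auto simp: bender_knuth_def)
  next
    case False
    then show ?thesis using cell row_less[of x] by (auto simp: bender_knuth_def)
  qed
qed

lemma row_less_bender_knuth:
  assumes "partition l" "T \<in> ssyt l"
  shows "row_less l (bender_knuth l i T) x r = (if x = i + 1 then reflected l i T r else row_less l T x r)"
proof (rule row_less_eqI)
  show "(if x = i + 1 then reflected l i T r else row_less l T x r) \<le> l r"
    using reflected_bounds(2)[OF assms, of i r] row_less_le[of l T "i + 2" r] row_less_le[of l T x r] by auto
qed (rule bender_knuth_less_iff[OF assms])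

lemma bender_knuth_ssyt:
  assumes "partition l" "T \<in> ssyt l"
  shows "bender_knuth l i T \<in> ssyt l"
proof (rule ssytI_thresholds[OF assms(1) _ bender_knuth_less_iff[OF assms]])
  show "bender_knuth l i T \<in> extensional (cells l)" by (simp add: bender_knuth_def)
  show "(if Suc x = i + 1 then reflected l i T (Suc r) else row_less l T (Suc x) (Suc r))
      \<le> (if x = i + 1 then reflected l i T r else row_less l T x r)" for x r
    using reflected_bounds(3,4)[OF assms, where i = i and r = r] row_less_interlace[OF assms, of x r] by auto
qed

lemma bender_knuth_involution:
  assumes "partition l" "T \<in> ssyt l"
  shows "bender_knuth l i (bender_knuth l i T) = T"
proof
  fix rj :: "nat \<times> nat"
  obtain r j where rj: "rj = (r, j)" by (cases rj)
  show "bender_knuth l i (bender_knuth l i T) rj = T rj"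
  proof (cases "rj \<in> cells l")
    case False
    then have "T rj = undefined" using assms(2) by (intro extensional_arb) (auto simp: ssyt_def)
    then show ?thesis using False by (simp add: bender_knuth_def)
  next
    case True
    then have j: "j < l r" by (simp add: rj cells_def)
    have "row_less l (bender_knuth l i T) i = row_less l T i" "row_less l (bender_knuth l i T) (i + 2) = row_less l T (i + 2)"
      by (simp_all add: fun_eq_iff row_less_bender_knuth[OF assms])
    then have "reflected l i (bender_knuth l i T) r = row_less l T (i + 1) r"
      using row_less_between[OF assms, of i r]
      unfolding reflected_def[of l i "bender_knuth l i T"] by (simp only: row_less_bender_knuth[OF assms]) (simp add: reflected_def)
    moreover have "T (r, j) < i + 1 \<longleftrightarrow> j < row_less l T (i + 1) r"
      by (rule entry_less_iff[OF assms(2) j])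
    ultimately show ?thesis using True by (auto simp: bender_knuth_def rj)
  qed
qed

lemma partition_bound:
  assumes "partition l"
  obtains L where "\<And>r. L \<le> r \<Longrightarrow> l r = 0"
proof -
  have "finite {r. l r \<noteq> 0}" using assms by (simp add: partition_def)
  then obtain L where "{r. l r \<noteq> 0} \<subseteq> {..<L}" using finite_nat_bounded by blast
  then show ?thesis by (intro that[of L]) (auto simp: subset_iff)
qed

lemma cells_Sigma: "(\<And>r. L \<le> r \<Longrightarrow> l r = 0) \<Longrightarrow> cells l = (SIGMA r:{..<L}. {..<l r})"
  by (auto simp: cells_def) (metis linorder_not_less not_less_zero)

lemma finite_cells: "partition l \<Longrightarrow> finite (cells l)"
  using cells_Sigma by (metis partition_bound finite_SigmaI finite_lessThan)

lemma card_less_eq_sum_row_less: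
  assumes "\<And>r. L \<le> r \<Longrightarrow> l r = 0"
  shows "card {c \<in> cells l. T c < x} = (\<Sum>r<L. row_less l T x r)"
proof -
  have "{c \<in> cells l. T c < x} = (SIGMA r:{..<L}. {j. j < l r \<and> T (r, j) < x})"
    using cells_Sigma[of L l] assms by auto
  then show ?thesis by (simp add: row_less_def)
qed

text \<open>The entries equal to \<open>i\<close> and \<open>i + 1\<close> number \<open>|b| - |a|\<close> and \<open>|c| - |b|\<close>, where \<open>a\<close>, \<open>b\<close>, \<open>c\<close> are the
  shapes of the entries below \<open>i\<close>, \<open>i + 1\<close>, \<open>i + 2\<close>; the reflection exchanges these two numbers.\<close>

lemma card_bender_knuth:
  assumes "partition l" "T \<in> ssyt l"
  shows "card {c \<in> cells l. bender_knuth l i T c = x} = card {c \<in> cells l. T c = transpose i (Suc i) x}"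
proof -
  obtain L where L: "\<And>r. L \<le> r \<Longrightarrow> l r = 0" using partition_bound[OF assms(1)] by blast
  define N where "N x = (\<Sum>r<L. row_less l T x r)" for x
  define N' where "N' x = (\<Sum>r<L. row_less l (bender_knuth l i T) x r)" for x
  have eq: "card {c \<in> cells l. S c = x} + (\<Sum>r<L. row_less l S x r) = (\<Sum>r<L. row_less l S (Suc x) r)"
    for S x
  proof -
    have "{c \<in> cells l. S c < Suc x} = {c \<in> cells l. S c = x} \<union> {c \<in> cells l. S c < x}" by auto
    then have "card {c \<in> cells l. S c < Suc x} = card {c \<in> cells l. S c = x} + card {c \<in> cells l. S c < x}"
      using finite_cells[OF assms(1)] by (auto simp: card_Un_disjoint disjoint_iff)
    then show ?thesis using card_less_eq_sum_row_less[of L l S] L by simp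
  qed
  have other: "N' x = N x" if "x \<noteq> Suc i" for x
    using that by (simp add: N_def N'_def row_less_bender_knuth[OF assms])
  have "N' (Suc i) + N (Suc i) =
      (\<Sum>r<L. upper_end (row_less l T i) (row_less l T (i + 2)) r + lower_end (row_less l T i) (row_less l T (i + 2)) r)"
    unfolding N_def N'_def sum.distrib[symmetric]
    using row_less_between[OF assms, of i]
    by (intro sum.cong) (auto simp: row_less_bender_knuth[OF assms] reflected_def trans_le_add1)
  also have "\<dots> = N i + N (i + 2)"
  proof -
    have "row_less l T (i + 2) L = 0" using row_less_le[of l T "i + 2" L] L[of L] by simp
    then show ?thesis
      using sum_upper_lower_end[of "row_less l T i" "row_less l T (i + 2)" L]
      by (simp add: N_def sum.distrib upper_end_def split: nat.splits)
  qed
  \<comment> \<open>the size of the middle shape before and after the reflection\<close>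
  finally have key: "N' (Suc i) + N (Suc i) = N i + N (Suc (Suc i))" by simp
  have T: "card {c \<in> cells l. T c = y} + N y = N (Suc y)" for y unfolding N_def by (rule eq)
  have T': "card {c \<in> cells l. bender_knuth l i T c = y} + N' y = N' (Suc y)" for y unfolding N'_def by (rule eq)
  consider "x = i" | "x = Suc i" | "x \<noteq> i" "x \<noteq> Suc i" by blast
  then show ?thesis
  proof cases
    case 1
    then show ?thesis using T[of "Suc i"] T'[of i] key other[of i] by simp
  next
    case 2
    then show ?thesis using T[of i] T'[of "Suc i"] key other[of "Suc (Suc i)"] by simp
  next
    case 3
    then show ?thesis using T[of x] T'[of x] other[of x] other[of "Suc x"] by simp
  qed
qed

definition content :: "nat \<Rightarrow> (nat \<Rightarrow> nat) \<Rightarrow> (nat \<times> nat \<Rightarrow> nat) \<Rightarrow> (nat \<times> nat) multiset" where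
  "content k l T = image_mset (\<lambda>c. (k, T c)) (mset_set (cells l))"

lemma content_bender_knuth:
  assumes "partition l" "T \<in> ssyt l"
  shows "content k l (bender_knuth l i T) = image_mset (map_prod id (transpose i (Suc i))) (content k l T)"
proof -
  have cnt: "count (image_mset f (mset_set (cells l))) x = card {c \<in> cells l. f c = x}" for f :: "_ \<Rightarrow> nat" and x
    using finite_cells[OF assms(1)] by (simp add: count_conv_size_mset filter_mset_image_mset)
  have "image_mset (bender_knuth l i T) (mset_set (cells l))
      = image_mset (\<lambda>c. transpose i (Suc i) (T c)) (mset_set (cells l))"
  proof (rule multiset_eqI)
    fix x
    have "transpose i (Suc i) (T c) = x \<longleftrightarrow> T c = transpose i (Suc i) x" for c
      by (metis transpose_involutory)
    then show "count (image_mset (bender_knuth l i T) (mset_set (cells l))) x =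
      count (image_mset (\<lambda>c. transpose i (Suc i) (T c)) (mset_set (cells l))) x"
      unfolding cnt card_bender_knuth[OF assms] by simp
  qed
  then have "image_mset (Pair k) (image_mset (bender_knuth l i T) (mset_set (cells l)))
      = image_mset (Pair k) (image_mset (\<lambda>c. transpose i (Suc i) (T c)) (mset_set (cells l)))"
    by simp
  then show ?thesis by (simp add: content_def image_mset.compositionality comp_def)
qed

lemma mcoeff_schur: "mcoeff (schur k l) M = of_nat (card {T \<in> ssyt l. content k l T = M})"
  by (simp add: schur_def content_def MSeries_inverse)

text \<open>The involution is a bijection between the tableaux counted by the two coefficients.\<close>

theorem schur_transpose_invariant:
  assumes "partition l"
  shows "mcoeff (schur k l) (image_mset (map_prod id (transpose i (Suc i))) M) = mcoeff (schur k l) M"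
proof -
  let ?\<tau> = "image_mset (map_prod id (transpose i (Suc i))) :: (nat \<times> nat) multiset \<Rightarrow> _"
  have \<tau>\<tau>: "?\<tau> (?\<tau> M) = M" for M :: "(nat \<times> nat) multiset"
    by (simp add: image_mset.compositionality comp_def map_prod_def case_prod_beta)
  have "bij_betw (bender_knuth l i) {T \<in> ssyt l. content k l T = M} {T \<in> ssyt l. content k l T = ?\<tau> M}"
    by (rule bij_betw_byWitness[where f' = "bender_knuth l i"])
      (auto simp: bender_knuth_involution[OF assms] bender_knuth_ssyt[OF assms] content_bender_knuth[OF assms] \<tau>\<tau>)
  then show ?thesis by (simp add: mcoeff_schur bij_betw_same_card)
qed

section \<open>Symmetric functions as combinations of power sum products\<close>

definition perm_invariant :: "(nat \<Rightarrow> nat) \<Rightarrow> series \<Rightarrow> bool" where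
  "perm_invariant \<pi> f \<longleftrightarrow> (\<forall>M. mcoeff f (image_mset (map_prod id \<pi>) M) = mcoeff f M)"

lemma image_mset_perm_inverse:
  assumes "bij \<pi>"
  shows "image_mset (map_prod id (inv \<pi>)) (image_mset (map_prod id \<pi>) M) = (M :: ('v \<times> nat) multiset)"
    and "image_mset (map_prod id \<pi>) (image_mset (map_prod id (inv \<pi>)) M) = (M :: ('v \<times> nat) multiset)"
  using inv_o_cancel[OF bij_is_inj[OF assms]] surj_iff[THEN iffD1, OF bij_is_surj[OF assms]]
  by (simp_all add: image_mset.compositionality map_prod.comp map_prod.id)

text \<open>Renaming variables is a ring automorphism.\<close>

lemma perm_invariant_mult:
  assumes "bij \<pi>" "perm_invariant \<pi> f" "perm_invariant \<pi> g"
  shows "perm_invariant \<pi> (f * g)"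
  unfolding perm_invariant_def
proof
  fix M :: "(nat \<times> nat) multiset"
  let ?P = "image_mset (map_prod id \<pi>) :: (nat \<times> nat) multiset \<Rightarrow> _"
  let ?Q = "image_mset (map_prod id (inv \<pi>)) :: (nat \<times> nat) multiset \<Rightarrow> _"
  note PQ = image_mset_perm_inverse[OF assms(1), where ?'v = nat]
  have "(\<Sum>(A, B)\<in>{(A, B). A + B = ?P M}. mcoeff f A * mcoeff g B)
      = (\<Sum>(A, B)\<in>{(A, B). A + B = M}. mcoeff f (?P A) * mcoeff g (?P B))"
    by (rule sum.reindex_bij_witness[where i = "\<lambda>(A, B). (?P A, ?P B)" and j = "\<lambda>(A, B). (?Q A, ?Q B)"])
      (auto simp: PQ simp flip: image_mset_union)
  then show "mcoeff (f * g) (?P M) = mcoeff (f * g) M"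
    using assms(2,3) by (simp add: mcoeff_mult perm_invariant_def)
qed

lemma perm_invariant_psum:
  assumes "bij \<pi>"
  shows "perm_invariant \<pi> (psum k r)"
proof -
  have "(\<exists>i. image_mset (map_prod id \<pi>) M = replicate_mset r (k, i)) \<longleftrightarrow> (\<exists>i. M = replicate_mset r (k, i))"
    for M
  proof
    assume "\<exists>i. image_mset (map_prod id \<pi>) M = replicate_mset r (k, i)"
    then obtain i where "image_mset (map_prod id \<pi>) M = replicate_mset r (k, i)" ..
    then have "M = replicate_mset r (k, inv \<pi> i)"
      using image_mset_perm_inverse(1)[OF assms, of M] by simp
    then show "\<exists>i. M = replicate_mset r (k, i)" by blast
  qed auto
  then show ?thesis by (simp add: perm_invariant_def mcoeff_psum)
qed

lemma perm_invariant_psum_prod: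
  assumes "bij \<pi>"
  shows "perm_invariant \<pi> (psum_prod X)"
proof (induction X)
  case empty
  show ?case by (simp add: perm_invariant_def mcoeff_1)
next
  case (add x X)
  then show ?case using assms by (simp add: perm_invariant_mult perm_invariant_psum)
qed

lemma psum_prod_support:
  assumes "mcoeff (psum_prod X) M \<noteq> 0"
  shows "size M = (\<Sum>x\<in>#X. snd x)" "fst ` set_mset M \<subseteq> fst ` set_mset X"
proof -
  have "size M = (\<Sum>x\<in>#X. snd x) \<and> fst ` set_mset M \<subseteq> fst ` set_mset X"
    using assms
  proof (induction X arbitrary: M)
    case empty
    then show ?case by (simp add: mcoeff_1 split: if_splits)
  next
    case (add x X)
    then obtain i M' where M: "M = replicate_mset (snd x) (fst x, i) + M'"
      "mcoeff (psum_prod X) M' \<noteq> 0" unfolding mcoeff_psum_prod_add_mset by blast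
    then show ?case using add.IH[OF M(2)] by auto
  qed
  then show "size M = (\<Sum>x\<in>#X. snd x)" "fst ` set_mset M \<subseteq> fst ` set_mset X"
    by (rule conjunct1, rule conjunct2)
qed

lemma subspace_Sym: "mseries.subspace (Sym k)"
proof (rule mseries.subspaceI)
  show "0 \<in> Sym k" by (simp add: Sym_def)
next
  fix f g assume f: "f \<in> Sym k" and g: "g \<in> Sym k"
  then obtain d d' where d: "\<And>M. mcoeff f M \<noteq> 0 \<Longrightarrow> size M \<le> d"
      "\<And>M. mcoeff g M \<noteq> 0 \<Longrightarrow> size M \<le> d'"
    unfolding Sym_def by blast
  have "size M \<le> max d d' \<and> (\<forall>v\<in>#M. fst v = k)" if "mcoeff (f + g) M \<noteq> 0" for M
  proof -
    have "mcoeff f M \<noteq> 0 \<or> mcoeff g M \<noteq> 0" using that by auto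
    then show ?thesis using d[of M] f g by (auto simp: Sym_def)
  qed
  moreover have "mcoeff (f + g) (image_mset (map_prod id \<pi>) M) = mcoeff (f + g) M" if "bij \<pi>" for \<pi> M
    using f g that by (simp add: Sym_def)
  ultimately show "f + g \<in> Sym k" unfolding Sym_def by blast
next
  fix c f assume "f \<in> Sym k"
  then show "mscale c f \<in> Sym k" by (auto simp: Sym_def)
qed

lemma psum_prod_Sym:
  assumes "\<And>x. x \<in># X \<Longrightarrow> fst x = k"
  shows "psum_prod X \<in> Sym k"
proof -
  have "\<forall>v\<in>#M. fst v = k" if "mcoeff (psum_prod X) M \<noteq> 0" for M
    using psum_prod_support(2)[OF that] assms by auto
  moreover have "\<exists>d. \<forall>M. mcoeff (psum_prod X) M \<noteq> 0 \<longrightarrow> size M \<le> d"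
    using psum_prod_support(1) by (metis order_refl)
  ultimately show ?thesis
    using perm_invariant_psum_prod unfolding Sym_def perm_invariant_def by blast
qed

text \<open>Homogeneous series of degree \<open>d\<close> in the \<open>k\<close>-th alphabet, with the symmetry that the Bender--Knuth
  involutions provide. Invariance under all permutations will be a consequence.\<close>

definition adj_symmetric :: "nat \<Rightarrow> nat \<Rightarrow> series set" where
  "adj_symmetric k d = {f. (\<forall>M. mcoeff f M \<noteq> 0 \<longrightarrow> size M = d \<and> (\<forall>v\<in>#M. fst v = k)) \<and>
     (\<forall>i. perm_invariant (transpose i (Suc i)) f)}"

lemma subspace_adj_symmetric: "mseries.subspace (adj_symmetric k d)"
proof (rule mseries.subspaceI)
  fix f g assume f: "f \<in> adj_symmetric k d" and g: "g \<in> adj_symmetric k d"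
  have "size M = d \<and> (\<forall>v\<in>#M. fst v = k)" if "mcoeff (f + g) M \<noteq> 0" for M
  proof -
    have "mcoeff f M \<noteq> 0 \<or> mcoeff g M \<noteq> 0" using that by auto
    then show ?thesis using f g by (auto simp: adj_symmetric_def)
  qed
  then show "f + g \<in> adj_symmetric k d"
    using f g by (auto simp: adj_symmetric_def perm_invariant_def)
qed (auto simp: adj_symmetric_def perm_invariant_def)

text \<open>The monomials whose exponents form a partition.\<close>

definition dominant :: "nat \<Rightarrow> nat \<Rightarrow> (nat \<times> nat) multiset set" where
  "dominant k d = {M. size M = d \<and> (\<forall>v\<in>#M. fst v = k) \<and> antimono (\<lambda>i. count M (k, i))}"

text \<open>If the \<open>i\<close>-th variable occurs, so do all earlier ones, hence \<open>i < d\<close>.\<close>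

lemma finite_dominant: "finite (dominant k d)"
proof (rule finite_subset)
  show "dominant k d \<subseteq> multisets_of_size ({k} \<times> {..<d}) d"
  proof
    fix M assume M: "M \<in> dominant k d"
    have "i < d" if "(k, i) \<in># M" for i
    proof -
      have "(k, j) \<in># M" if "j \<le> i" for j
        using M antimonoD[of "\<lambda>i. count M (k, i)", OF _ that] \<open>(k, i) \<in># M\<close>
        by (simp add: dominant_def flip: count_greater_zero_iff)
      then have "mset_set (Pair k ` {..i}) \<subseteq># M"
        by (auto simp: subseteq_mset_def count_mset_set' Suc_le_eq)
      from size_mset_mono[OF this] show ?thesis
        using M by (simp add: card_image inj_on_def dominant_def)
    qed
    then show "M \<in> multisets_of_size ({k} \<times> {..<d}) d"
      using M by (force simp: multisets_of_size_def dominant_def)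
  qed
qed auto

lemma shape_inj_dominant: "inj_on shape (dominant k d)"
proof (rule inj_onI)
  fix M M' assume M: "M \<in> dominant k d" and M': "M' \<in> dominant k d" and eq: "shape M = shape M'"
  have *: "image_mset (\<lambda>i. count M (k, i)) (mset_set {i. count M (k, i) \<noteq> 0}) = image_mset snd (shape M)"
    "finite {i. count M (k, i) \<noteq> 0}" if "M \<in> dominant k d" for M
  proof -
    have set: "set_mset M = Pair k ` {i. count M (k, i) \<noteq> 0}"
      using that by (force simp: dominant_def)
    from this show "finite {i. count M (k, i) \<noteq> 0}"
      by (metis finite_imageD finite_set_mset inj_onI prod.inject)
    have "image_mset snd (shape M) = image_mset (count M) (image_mset (Pair k) (mset_set {i. count M (k, i) \<noteq> 0}))"
      unfolding shape_def set
      by (subst image_mset_mset_set) (simp_all add: inj_on_def image_mset.compositionality comp_def)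
    then show "image_mset (\<lambda>i. count M (k, i)) (mset_set {i. count M (k, i) \<noteq> 0}) = image_mset snd (shape M)"
      by (simp add: image_mset.compositionality comp_def)
  qed
  have "(\<lambda>i. count M (k, i)) = (\<lambda>i. count M' (k, i))"
    using M M' *[OF M] *[OF M'] eq by (intro antimono_determined_by_parts) (auto simp: dominant_def)
  then have "count M (k, i) = count M' (k, i)" for i by meson
  moreover have "count M v = 0" "count M' v = 0" if "fst v \<noteq> k" for v
    using M M' that by (auto simp: dominant_def count_eq_zero_iff)
  ultimately show "M = M'" by (intro multiset_eqI) (metis prod.collapse)
qed

text \<open>Among the monomials that occur choose one with the smallest sum of indices. If some exponent were
  smaller than the next one, exchanging the two variables would make the sum of indices smaller;
  hence the monomial is dominant.\<close>

lemma adj_symmetric_eq_0: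
  assumes h: "h \<in> adj_symmetric k d" and 0: "\<And>M. M \<in> dominant k d \<Longrightarrow> mcoeff h M = 0"
  shows "h = 0"
proof (rule mseries_eqI)
  fix M
  have "mcoeff h M = 0"
  proof (induction "\<Sum>v\<in>#M. snd v" arbitrary: M rule: less_induct)
    case less
    show ?case
    proof (rule ccontr)
      assume nz: "mcoeff h M \<noteq> 0"
      then have M: "size M = d" "\<And>v. v \<in># M \<Longrightarrow> fst v = k" using h by (auto simp: adj_symmetric_def)
      have "count M (k, Suc i) \<le> count M (k, i)" for i
      proof (rule ccontr)
        assume gt: "\<not> count M (k, Suc i) \<le> count M (k, i)"
        let ?M' = "image_mset (map_prod id (transpose i (Suc i))) M"
        have "(\<Sum>v\<in>#image_mset (map_prod id (transpose i (Suc i))) N. snd v) + count N (k, Suc i)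
            = (\<Sum>v\<in>#N. snd v) + count N (k, i)" if "\<And>v. v \<in># N \<Longrightarrow> fst v = k" for N
          using that
        proof (induction N)
          case (add v N)
          then have "fst v = k" by simp
          then obtain b where "v = (k, b)" by (cases v) simp
          then show ?case using add by (auto simp: transpose_def)
        qed simp
        from this[of M] have "(\<Sum>v\<in>#?M'. snd v) < (\<Sum>v\<in>#M. snd v)" using M(2) gt by simp
        from less.hyps[OF this] have "mcoeff h M = 0"
          using h by (simp add: adj_symmetric_def perm_invariant_def)
        then show False using nz by simp
      qed
      then have "M \<in> dominant k d"
        using M by (simp add: dominant_def antimono_iff_le_Suc)
      then show False using 0 nz by simp
    qed
  qed
  then show "mcoeff h M = mcoeff 0 M" by simp
qed

text \<open>By triangularity some combination \<open>g\<close> of the products of power sums of degree \<open>d\<close> agrees with \<open>f\<close> at all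
  dominant monomials, and these determine an element of \<open>adj_symmetric k d\<close>.\<close>

theorem adj_symmetric_psum_prod:
  assumes f: "f \<in> adj_symmetric k d"
  shows "f \<in> mseries.span (psum_prod ` {X. \<forall>x\<in>#X. fst x = k \<and> snd x > 0})"
proof -
  let ?D = "dominant k d"
  let ?v = "\<lambda>M. psum_prod (shape M)"
  have shape: "\<forall>x\<in>#shape M. fst x = k \<and> snd x > 0" if "M \<in> ?D" for M
    using that by (auto simp: shape_def dominant_def)
  have sizes: "(\<Sum>x\<in>#shape M. snd x) = size M" for M
    by (simp add: shape_def image_mset.compositionality comp_def size_multiset_overloaded_eq
        sum_unfold_sum_mset)
  have "\<exists>g\<in>mseries.span (?v ` ?D). \<forall>M\<in>?D. mcoeff g M = mcoeff f M"
  proof (rule triangular_solve[OF finite_dominant])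
    show "mcoeff (?v M) M \<noteq> 0" for M by (rule mcoeff_psum_prod_shape)
    fix M N assume MN: "M \<in> ?D" "N \<in> ?D" "M \<noteq> N" and nz: "mcoeff (?v M) N \<noteq> 0"
    have "shape N \<noteq> shape M" using shape_inj_dominant MN by (auto dest: inj_onD)
    then show "energy (shape M) < energy (shape N)"
      using psum_prod_triangular[OF nz] shape[OF MN(1)] by (meson linorder_not_less)
  qed
  then obtain g where g: "g \<in> mseries.span (?v ` ?D)" "\<And>M. M \<in> ?D \<Longrightarrow> mcoeff g M = mcoeff f M"
    by blast
  have "?v M \<in> adj_symmetric k d" if "M \<in> ?D" for M
  proof -
    have "size N = d \<and> (\<forall>v\<in>#N. fst v = k)" if "mcoeff (?v M) N \<noteq> 0" for N
      using psum_prod_support[OF that] sizes shape[OF \<open>M \<in> ?D\<close>] \<open>M \<in> ?D\<close>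
      by (fastforce simp: dominant_def)
    then show ?thesis by (simp add: adj_symmetric_def perm_invariant_psum_prod)
  qed
  then have "g \<in> adj_symmetric k d"
    using g(1) mseries.span_minimal[OF _ subspace_adj_symmetric, of "?v ` ?D"] by blast
  then have "f - g \<in> adj_symmetric k d"
    using f by (intro mseries.subspace_diff[OF subspace_adj_symmetric])
  then have "f - g = 0" by (rule adj_symmetric_eq_0) (simp add: g(2))
  moreover have "mseries.span (?v ` ?D) \<subseteq> mseries.span (psum_prod ` {X. \<forall>x\<in>#X. fst x = k \<and> snd x > 0})"
    using shape by (intro mseries.span_mono) auto
  ultimately show ?thesis using g(1) by auto
qed

lemma schur_adj_symmetric:
  assumes "partition l"
  shows "schur k l \<in> adj_symmetric k (card (cells l))"
proof -
  have "size M = card (cells l) \<and> (\<forall>v\<in>#M. fst v = k)" if "mcoeff (schur k l) M \<noteq> 0" for M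
  proof -
    have "{T \<in> ssyt l. content k l T = M} \<noteq> {}" using that unfolding mcoeff_schur by (metis card.empty of_nat_0)
    then obtain T where "content k l T = M" by blast
    then show ?thesis by (auto simp: content_def)
  qed
  then show ?thesis
    using schur_transpose_invariant[OF assms] by (simp add: adj_symmetric_def perm_invariant_def)
qed

lemma schur_psum_prod:
  "partition l \<Longrightarrow> schur k l \<in> mseries.span (psum_prod ` {X. \<forall>x\<in>#X. fst x = k \<and> snd x > 0})"
  by (rule adj_symmetric_psum_prod[OF schur_adj_symmetric])

lemma schur_ep_psum_span:
  assumes "primitive_root_of_unity e \<zeta>" "\<alpha> \<in> epartitions e"
  shows "schur_ep e \<alpha> \<in> psum_span e \<zeta>"
  unfolding schur_ep_def
proof (rule psum_span_prod)
  fix k assume "k \<in> {..<e}"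
  then have k: "k < e" and l: "partition (\<alpha> k)" using assms(2) by (auto simp: epartitions_def)
  have "psum_prod ` {X. \<forall>x\<in>#X. fst x = k \<and> snd x > 0} \<subseteq> psum_span e \<zeta>"
    using psum_prod_psum_span[OF assms(1)] k by (fastforce simp: index_multisets_def)
  then have "mseries.span (psum_prod ` {X. \<forall>x\<in>#X. fst x = k \<and> snd x > 0}) \<subseteq> psum_span e \<zeta>"
    by (intro mseries.span_minimal) (simp_all add: psum_span_def mseries.subspace_span)
  then show "schur k (\<alpha> k) \<in> psum_span e \<zeta>" using schur_psum_prod[OF l] by blast
qed

lemma schur_Sym:
  assumes "partition l"
  shows "schur k l \<in> Sym k"
proof -
  have "mseries.span (psum_prod ` {X. \<forall>x\<in>#X. fst x = k \<and> snd x > 0}) \<subseteq> Sym k"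
    using psum_prod_Sym by (intro mseries.span_minimal subspace_Sym) auto
  then show ?thesis using schur_psum_prod[OF assms] by blast
qed

lemma schur_ep_Xi: "\<alpha> \<in> epartitions e \<Longrightarrow> schur_ep e \<alpha> \<in> Xi e"
  unfolding schur_ep_def Xi_def
  by (rule mseries.span_base) (auto simp: epartitions_def intro!: schur_Sym)

section \<open>Existence and uniqueness of the dual families\<close>

lemma finite_Z0: "finite (Z0 e m n)"
proof (rule finite_subset)
  let ?h = "\<lambda>f k j. if (k, j) \<in> positions e m then f (k, j) else (0 :: nat)"
  show "Z0 e m n \<subseteq> ?h ` (positions e m \<rightarrow>\<^sub>E {..n})"
  proof
    fix \<alpha> assume \<alpha>: "\<alpha> \<in> Z0 e m n"
    have le: "\<alpha> k j \<le> n" if "k < e" for k j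
    proof (cases "\<alpha> k j = 0")
      case False
      have "finite {j. \<alpha> k j \<noteq> 0}" using \<alpha> that by (auto simp: Z0_def epartitions_def partition_def)
      then have "\<alpha> k j \<le> psize (\<alpha> k)"
        unfolding psize_def using False by (intro member_le_sum) auto
      also have "\<dots> \<le> (\<Sum>k<e. psize (\<alpha> k))" using that by (intro member_le_sum) auto
      finally show ?thesis using \<alpha> by (simp add: Z0_def)
    qed simp
    have "\<alpha> k j = 0" if "(k, j) \<notin> positions e m" for k j
      using \<alpha> that by (cases "k < e") (auto simp: Z0_def epartitions_def positions_def)
    then have "\<alpha> = ?h (\<lambda>(k, j)\<in>positions e m. \<alpha> k j)" by (auto simp: fun_eq_iff)
    moreover have "(\<lambda>(k, j)\<in>positions e m. \<alpha> k j) \<in> positions e m \<rightarrow>\<^sub>E {..n}"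
      using le by (auto simp: positions_def)
    ultimately show "\<alpha> \<in> ?h ` (positions e m \<rightarrow>\<^sub>E {..n})" by (rule image_eqI)
  qed
qed (auto intro!: finite_PiE simp: positions_def)

lemma symbol_inj: "inj (symbol e m r s)"
  by (rule injI) (simp add: symbol_def fun_eq_iff)

text \<open>Coefficients indexed by \<open>Z\<close> and vanishing outside \<open>L\<close> describe the span even if \<open>b\<close> is not
  injective.\<close>

lemma mem_span_image_iff:
  fixes b :: "'i \<Rightarrow> series"
  assumes "finite Z" "L \<subseteq> Z"
  shows "f \<in> mseries.span (b ` L) \<longleftrightarrow>
    (\<exists>u. (\<forall>\<beta>. u \<beta> \<noteq> 0 \<longrightarrow> \<beta> \<in> L) \<and> f = (\<Sum>\<beta>\<in>Z. mscale (u \<beta>) (b \<beta>)))"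
proof
  assume "f \<in> mseries.span (b ` L)"
  then show "\<exists>u. (\<forall>\<beta>. u \<beta> \<noteq> 0 \<longrightarrow> \<beta> \<in> L) \<and> f = (\<Sum>\<beta>\<in>Z. mscale (u \<beta>) (b \<beta>))"
  proof (induction rule: mseries.span_induct_alt)
    case base
    show ?case by (intro exI[of _ "\<lambda>_. 0"]) simp
  next
    case (step c x y)
    then obtain \<alpha> u where x: "\<alpha> \<in> L" "x = b \<alpha>"
      and u: "\<forall>\<beta>. u \<beta> \<noteq> 0 \<longrightarrow> \<beta> \<in> L" "y = (\<Sum>\<beta>\<in>Z. mscale (u \<beta>) (b \<beta>))" by blast
    have "mscale c x = (\<Sum>\<beta>\<in>Z. mscale (if \<beta> = \<alpha> then c else 0) (b \<beta>))"
    proof -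
      have "(\<Sum>\<beta>\<in>Z. mscale (if \<beta> = \<alpha> then c else 0) (b \<beta>)) = (\<Sum>\<beta>\<in>Z. if \<beta> = \<alpha> then mscale c (b \<beta>) else 0)"
        by (intro sum.cong) auto
      then show ?thesis using x assms by auto
    qed
    then show ?case using u x
      by (intro exI[of _ "\<lambda>\<beta>. (if \<beta> = \<alpha> then c else 0) + u \<beta>"])
        (auto simp: mseries.scale_left_distrib sum.distrib)
  qed
next
  assume "\<exists>u. (\<forall>\<beta>. u \<beta> \<noteq> 0 \<longrightarrow> \<beta> \<in> L) \<and> f = (\<Sum>\<beta>\<in>Z. mscale (u \<beta>) (b \<beta>))"
  then obtain u where u: "\<forall>\<beta>. u \<beta> \<noteq> 0 \<longrightarrow> \<beta> \<in> L" "f = (\<Sum>\<beta>\<in>Z. mscale (u \<beta>) (b \<beta>))" by blast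
  have "mscale (u \<beta>) (b \<beta>) \<in> mseries.span (b ` L)" for \<beta>
    using u(1) by (cases "u \<beta> = 0") (auto intro: mseries.span_zero mseries.span_scale mseries.span_base)
  then show "f \<in> mseries.span (b ` L)" unfolding u(2) by (intro mseries.span_sum)
qed

theorem proposition1p12:
  fixes e n r s :: nat and m :: "nat \<Rightarrow> nat" and \<zeta> :: complex
    and prec :: "(epart \<times> epart) set"
  assumes "e \<ge> 1"
    and "primitive_root_of_unity e \<zeta>"
    and "\<And>k. k < e \<Longrightarrow> m k > 0"
    and "r \<ge> s"
    and "admissible_order e m r s n prec"
  shows "\<exists>!(Pp, Pm).
      Pp \<in> symbols e m r s n \<rightarrow>\<^sub>E Xi e \<and>
      Pm \<in> symbols e m r s n \<rightarrow>\<^sub>E Xi e \<and>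
      (\<forall>\<alpha>\<in>Z0 e m n.
         unitriangular_at e m r s n prec \<alpha> (Pp (symbol e m r s \<alpha>)) \<and>
         unitriangular_at e m r s n prec \<alpha> (Pm (symbol e m r s \<alpha>))) \<and>
      (\<forall>L\<in>symbols e m r s n. \<forall>L'\<in>symbols e m r s n.
         \<not> similar e m L L' \<longrightarrow> Xi_form e \<zeta> (Pp L) (Pm L') = 0)"
proof -
  let ?Z = "Z0 e m n" and ?sym = "symbol e m r s" and ?S = "symbols e m r s n"
  have ep: "\<alpha> \<in> epartitions e" if "\<alpha> \<in> ?Z" for \<alpha> using that by (simp add: Z0_def)
  have prec: "prec \<subseteq> ?Z \<times> ?Z" "trans prec" "irrefl prec" "total_on ?Z prec"
    and interval: "\<And>\<alpha> \<beta> \<gamma>. \<lbrakk>(\<alpha>, \<beta>) \<in> prec; (\<beta>, \<gamma>) \<in> prec; similar_ep e m r s \<alpha> \<gamma>\<rbrakk> \<Longrightarrow> similar_ep e m r s \<alpha> \<beta>"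
    using assms(5) unfolding admissible_order_def strict_linear_order_on_def by blast+
  interpret anisotropic_form mscale "psum_span e \<zeta>" "Xi_form e \<zeta>" F_cnj
    by (rule anisotropic_Xi_form[OF assms(2)])
  interpret block_triangular mscale "psum_span e \<zeta>" "Xi_form e \<zeta>" F_cnj ?Z
    "\<lambda>\<alpha> \<beta>. (\<alpha>, \<beta>) \<in> prec" "similar_ep e m r s" "schur_ep e"
  proof unfold_locales
    show "similar_ep e m r s \<alpha> \<beta>" if "(\<alpha>, \<beta>) \<in> prec" "(\<beta>, \<gamma>) \<in> prec" "similar_ep e m r s \<alpha> \<gamma>" for \<alpha> \<beta> \<gamma>
      using interval that .
    show "schur_ep e \<alpha> \<in> psum_span e \<zeta>" if "\<alpha> \<in> ?Z" for \<alpha>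
      by (rule schur_ep_psum_span[OF assms(2) ep[OF that]])
    show "(\<alpha>, \<gamma>) \<in> prec" if "(\<alpha>, \<beta>) \<in> prec" "(\<beta>, \<gamma>) \<in> prec" for \<alpha> \<beta> \<gamma>
      using prec(2) that by (rule transD)
    show "(\<alpha>, \<beta>) \<in> prec \<or> (\<beta>, \<alpha>) \<in> prec" if "\<alpha> \<in> ?Z" "\<beta> \<in> ?Z" "\<alpha> \<noteq> \<beta>" for \<alpha> \<beta>
      using prec(4) that by (simp add: total_on_def)
    show "\<alpha> \<in> ?Z \<and> \<beta> \<in> ?Z" if "(\<alpha>, \<beta>) \<in> prec" for \<alpha> \<beta> using prec(1) that by blast
    show "(\<alpha>, \<alpha>) \<notin> prec" for \<alpha> using prec(3) by (simp add: irrefl_def)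
  qed (simp_all add: finite_Z0 similar_ep_def similar_def)
  have uni: "unitriangular_at e m r s n prec \<alpha> P \<longleftrightarrow> P - schur_ep e \<alpha> \<in> mseries.span (schur_ep e ` lower \<alpha>)"
    for \<alpha> P
    unfolding mem_span_image_iff[OF finite_Z0 lower_Z] unitriangular_at_def
    by (simp add: lower_def diff_eq_eq add.commute)
  have Xi: "P \<in> Xi e" if "unitriangular_at e m r s n prec \<alpha> P" "\<alpha> \<in> ?Z" for \<alpha> P
  proof -
    have "schur_ep e ` lower \<alpha> \<subseteq> Xi e" using schur_ep_Xi ep lower_Z by blast
    then have "P - schur_ep e \<alpha> \<in> Xi e"
      using that(1) mseries.span_minimal[of "schur_ep e ` lower \<alpha>" "Xi e"]
      unfolding uni by (auto simp: Xi_def)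
    moreover have "schur_ep e \<alpha> \<in> Xi e" using schur_ep_Xi ep that(2) by blast
    ultimately have "(P - schur_ep e \<alpha>) + schur_ep e \<alpha> \<in> Xi e" unfolding Xi_def by (rule mseries.span_add)
    then show ?thesis by simp
  qed
  \<comment> \<open>the condition in the theorem, as a predicate on pairs of functions on symbols\<close>
  define good where "good = (\<lambda>(Pp, Pm). Pp \<in> ?S \<rightarrow>\<^sub>E Xi e \<and> Pm \<in> ?S \<rightarrow>\<^sub>E Xi e \<and>
      (\<forall>\<alpha>\<in>?Z. unitriangular_at e m r s n prec \<alpha> (Pp (?sym \<alpha>)) \<and>
         unitriangular_at e m r s n prec \<alpha> (Pm (?sym \<alpha>))) \<and>
      (\<forall>L\<in>?S. \<forall>L'\<in>?S. \<not> similar e m L L' \<longrightarrow> Xi_form e \<zeta> (Pp L) (Pm L') = 0))"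
  \<comment> \<open>membership in \<open>Xi e\<close> follows from the triangular shape; \<open>extensional\<close> fixes the values off the symbols\<close>
  have good_iff: "good (Pp, Pm) \<longleftrightarrow> Pp \<in> extensional ?S \<and> Pm \<in> extensional ?S \<and>
      dual_pair (\<lambda>\<alpha>. Pp (?sym \<alpha>)) (\<lambda>\<alpha>. Pm (?sym \<alpha>))" for Pp Pm
    unfolding good_def dual_pair_def unitriangular_def uni[symmetric] PiE_def symbols_def
    using Xi by (auto simp: similar_ep_def)
  have "\<exists>!PP. good PP"
  proof (rule ex_ex1I)
    obtain P Q where PQ: "dual_pair P Q" using dual_pair_exists by blast
    define lift where "lift P = (\<lambda>L\<in>?S. P (inv ?sym L))" for P :: "epart \<Rightarrow> series"
    have lift: "lift P (?sym \<alpha>) = P \<alpha>" if "\<alpha> \<in> ?Z" for P \<alpha>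
      using that by (simp add: lift_def symbols_def inv_f_f[OF symbol_inj])
    have "dual_pair (\<lambda>\<alpha>. lift P (?sym \<alpha>)) (\<lambda>\<alpha>. lift Q (?sym \<alpha>))"
      using PQ unfolding dual_pair_def unitriangular_def by (simp add: lift)
    then have "good (lift P, lift Q)" by (simp add: good_iff) (simp add: lift_def)
    then show "\<exists>PP. good PP" by blast
  next
    fix PP QQ assume "good PP" "good QQ"
    moreover obtain Pp Pm where P: "PP = (Pp, Pm)" by (cases PP)
    moreover obtain Qp Qm where Q: "QQ = (Qp, Qm)" by (cases QQ)
    ultimately have ext: "Pp \<in> extensional ?S" "Pm \<in> extensional ?S" "Qp \<in> extensional ?S" "Qm \<in> extensional ?S"
      and dp: "dual_pair (\<lambda>\<alpha>. Pp (?sym \<alpha>)) (\<lambda>\<alpha>. Pm (?sym \<alpha>))"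
        "dual_pair (\<lambda>\<alpha>. Qp (?sym \<alpha>)) (\<lambda>\<alpha>. Qm (?sym \<alpha>))"
      by (simp_all add: good_iff)
    have "Pp = Qp" using dual_pair_unique(1)[OF dp]
      by (intro extensionalityI[OF ext(1,3)]) (auto simp: symbols_def)
    moreover have "Pm = Qm" using dual_pair_unique(2)[OF dp]
      by (intro extensionalityI[OF ext(2,4)]) (auto simp: symbols_def)
    ultimately show "PP = QQ" by (simp add: P Q)
  qed
  then show ?thesis by (simp only: good_def)
qed

end
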